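(* Let $P$ be a $p$-gP (a finite generalized program with finite rules whose only predicate different from (in)equality is $p$), with $p$ of arity $n$, let $U$ be a universe for $P$ and let $M$ be a set of ground atoms $p(\mathbf{x})$ with $\mathbf{x}\in U^n$. Then $(U,M)$ is an open answer set of $P$ if and only if $(U, M\cup R\cup G)$ is a model of $\bigwedge\mathrm{compgl}(P)$, where $$R \equiv \{\, r(\mathbf{y}) \mid r[\mathbf{Y}\mid\mathbf{y}] : \alpha[\,]\leftarrow\beta[\,] \in P_U,\ M\models \alpha[\,]^{-}\cup \mathrm{not}\,\beta[\,]^{-},\ \mathrm{vars}(r)=\mathbf{Y} \,\}$$ and $$G\equiv\{\, g(\mathbf{z})\mid g:\forall\mathbf{Y}.\,\phi\Rightarrow\psi \text{ a generalized literal in } P,\ \mathrm{vars}(\phi)=\mathbf{Z},\ \mathbf{z}\text{ in }U,\ M\models\phi[\mathbf{Z}\mid\mathbf{z}]\,\}.$$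
   Context: **Generalized programs.** Terms are constants and variables (no function symbols). A literal is an atom $q(\mathbf{t})$ or a naf-atom $\mathrm{not}\,q(\mathbf{t})$. Equality is a binary predicate; $t\neq s$ stands for $\mathrm{not}\,(t=s)$. A regular atom is an atom that is not an equality atom. A generalized literal is a formula $\forall\mathbf{Y}.\,\phi\Rightarrow\psi$ with $\phi$ a finite boolean combination (using $\neg,\vee,\wedge$) of atoms and $\psi$ an atom. A g-literal is a literal or a generalized literal. For a set $\alpha$ of g-literals, $\alpha^{\mathrm{x}}$ is its set of generalized literals, $\alpha^+$ its set of atoms, $\alpha^-=\{a\mid\mathrm{not}\,a\in\alpha\}$; for a set $X$ of atoms, $\mathrm{not}\,X=\{\mathrm{not}\,a\mid a\in X\}$. A rule is $\alpha\leftarrow\beta$ with $\alpha$ a finite set of literals, $|\alpha^+|\le1$, $\alpha^+$ containing no equality atom, and $\beta$ a countable set of g-literals. A generalized program (gP) is a finite set of rules with finite bodies (infinite ones occur only through grounding and reducts). $\mathrm{vars}(r)$ is the set of free variables of the g-literals of $r$. A universe $U$ for $P$ is a non-empty countable superset of the constants of $P$; $P_U$ is obtained by substituting the (free) variables of the rules by elements of $U$ in all possible ways; $o[\mathbf{Y}\mid\mathbf{y}]$ (or $o[\,]$) denotes such a grounding. For a set $I$ of ground regular atoms, $I\models a$ iff $a\in I$ for regular $a$; $I\models t=s$ iff $t,s$ are the same element; $I\models\mathrm{not}\,a$ iff $I\not\models a$; extended to boolean formulas of ground atoms as usual, and to sets conjunctively. For $(U,I)$ the GeLi-reduct $Q^{\mathrm{x}(U,I)}$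 of a ground gP $Q$ consists of the rules $\alpha\leftarrow(\beta\setminus\beta^{\mathrm{x}}),\ \bigcup_{\forall\mathbf{Y}.\phi\Rightarrow\psi\,\in\,\beta^{\mathrm{x}}}\{\psi[\mathbf{Y}|\mathbf{y}]\mid\mathbf{y}\subseteq U,\ I\models\phi[\mathbf{Y}|\mathbf{y}]\}$ for $\alpha\leftarrow\beta\in Q$. For a ground program $Q$ without generalized literals (bodies possibly infinite): $I$ satisfies $\alpha\leftarrow\beta$ if $I\models l$ for some $l\in\alpha$ whenever $I\models\beta$; if $Q$ has no $\mathrm{not}$, its answer sets are its subset-minimal models; in general $Q^I=\{\alpha^+\leftarrow\beta^+\mid\alpha\leftarrow\beta\in Q,\ I\models\mathrm{not}\,\beta^-,\ I\models\alpha^-\}$ and $I$ is an answer set of $Q$ if it is an answer set of $Q^I$. An open answer set of a gP $P$ is a pair $(U,M)$, $U$ a universe for $P$, $M$ a set of ground regular atoms over the predicates of $P$ and $U$, with $M$ an answer set of $(P_U)^{\mathrm{x}(U,M)}$. **Fixed point logic (FPL).** First-order logic with equality (interpreted as identity) extended with formulas $[\mathrm{LFP}\,W\mathbf{X}.\psi(W,\mathbf{X})](\mathbf{X})$, with $W$ an $n$-ary predicate variable occurring only positively in $\psi$, and all free variables of $\psi$ in $\mathbf{X}$; $(U,M)\models[\mathrm{LFP}\,W\mathbf{X}.\psi](\mathbf{x})$ iff $\mathbf{x}$ belongs to the least fixed point of $S\mapsto\{\mathbf{x}\in U^n\mid (U,M),W\to S\models\psi(W,\mathbf{x})\}$. An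 interpretation is written $(U,N)$ with $U$ the domain and $N$ the set of true ground atoms; constants of $P$ are interpreted as themselves. **The completion.** In formulas, $\mathrm{not}\,a$ is read as $\neg a$; $\bigwedge\emptyset=\mathbf{true}$, $\bigvee\emptyset=\mathbf{false}$. Rules and generalized literals of $P$ have unique names $r$, $g$, also used as new predicate symbols. $\mathrm{compgl}(P)$ consists of: - $a\neq b$ for every pair of different constants $a,b$ in $P$, and $\exists X.\mathbf{true}$; - for every rule $r:\alpha\leftarrow\beta\in P$ with $\mathrm{vars}(r)=\mathbf{Y}$: $\forall\mathbf{Y}.\ \bigwedge\beta\Rightarrow\bigvee\alpha$ and $\forall\mathbf{Y}.\ r(\mathbf{Y})\Leftrightarrow\bigwedge\alpha^-\wedge\bigwedge\neg\beta^-$; - for every generalized literal $g:\forall\mathbf{Y}.\phi\Rightarrow\psi$ in $P$, where $\mathbf{Z}$ are the variables of $\phi$: $\forall\mathbf{Z}.\ g(\mathbf{Z})\Leftrightarrow\phi$; - $\forall\mathbf{X}.\ p(\mathbf{X})\Rightarrow[\mathrm{LFP}\,W\mathbf{X}.\phi(W,\mathbf{X})](\mathbf{X})$, where $\mathbf{X}=X_1,\dots,X_n$ are new variables, $\phi(W,\mathbf{X})\equiv W(\mathbf{X})\vee\bigvee_{r:\,p(\mathbf{t})\vee\alpha\leftarrow\beta\,\in P}E(r)$ and $E(r)\equiv\exists\mathbf{Y}.\ X_1=t_1\wedge\dots\wedge X_n=t_n\wedge\bigwedge\beta^+[p|W]\wedge\bigwedge\gamma\wedge r(\mathbf{Y})$,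 with $\mathbf{Y}=\mathrm{vars}(r)$, $\beta^+[p|W]$ being $\beta^+$ with $p$ replaced by $W$, and $\gamma$ being $\beta^{\mathrm{x}}$ with every generalized literal $g:\forall\mathbf{Y}'.\phi\Rightarrow\psi$ replaced by $\forall\mathbf{Y}'.\,g(\mathbf{Z})\Rightarrow\psi$ ($\mathbf{Z}$ the variables of $\phi$) and subsequently every $p$ replaced by $W$. *)

theory Defs
  imports Complex_Main "HOL-Library.Countable_Set"
begin

section \<open>Generalized programs\<close>

type_synonym var = nat

datatype 'c trm = Var var | Const 'c

datatype ('p, 'c) atom = Rel 'p "'c trm list" | Equ "'c trm" "'c trm"

datatype 'a lit = Pos 'a | Naf 'a

datatype 'a bform = BAtom 'a | BNot "'a bform" | BAnd "'a bform" "'a bform" | BOr "'a bform" "'a bform"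

text \<open>\<open>Gen Ys \<phi> \<psi>\<close> is the generalized literal \<open>\<forall>Ys. \<phi> \<Rightarrow> \<psi>\<close>.\<close>

datatype 'a gliteral = Lit "'a lit" | Gen "var list" "'a bform" 'a

text \<open>
  \<open>Rule \<alpha> \<beta>\<close> is \<open>\<alpha> \<leftarrow> \<beta>\<close>.  The second type parameter is the type of body elements:
  g-literals in generalized programs, plain literals in programs without generalized literals.
\<close>

datatype ('a, 'b) rule = Rule (head: "'a lit set") (body: "'b set")

type_synonym ('p, 'c) grule = "(('p, 'c) atom, ('p, 'c) atom gliteral) rule"
type_synonym ('p, 'c) lrule = "(('p, 'c) atom, ('p, 'c) atom lit) rule"

definition pos :: "'a lit set \<Rightarrow> 'a set" where
  "pos A = {a. Pos a \<in> A}"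

definition neg :: "'a lit set \<Rightarrow> 'a set" where
  "neg A = {a. Naf a \<in> A}"

definition lits :: "'a gliteral set \<Rightarrow> 'a lit set" where
  "lits B = {l. Lit l \<in> B}"

definition gens :: "'a gliteral set \<Rightarrow> 'a gliteral set" where
  "gens B = {g \<in> B. \<exists>Ys \<phi> \<psi>. g = Gen Ys \<phi> \<psi>}"

fun vars_trm :: "'c trm \<Rightarrow> var set" where
  "vars_trm (Var x) = {x}"
| "vars_trm (Const c) = {}"

fun trms_atom :: "('p, 'c) atom \<Rightarrow> 'c trm set" where
  "trms_atom (Rel q ts) = set ts"
| "trms_atom (Equ s t) = {s, t}"

definition vars_atom :: "('p, 'c) atom \<Rightarrow> var set" where
  "vars_atom a = \<Union> (vars_trm ` trms_atom a)"

definition vars_bform :: "('p, 'c) atom bform \<Rightarrow> var set" where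
  "vars_bform \<phi> = \<Union> (vars_atom ` set_bform \<phi>)"

definition vars_lit :: "('p, 'c) atom lit \<Rightarrow> var set" where
  "vars_lit l = \<Union> (vars_atom ` set_lit l)"

fun free_vars_gliteral :: "('p, 'c) atom gliteral \<Rightarrow> var set" where
  "free_vars_gliteral (Lit l) = vars_lit l"
| "free_vars_gliteral (Gen Ys \<phi> \<psi>) = (vars_bform \<phi> \<union> vars_atom \<psi>) - set Ys"

fun all_vars_gliteral :: "('p, 'c) atom gliteral \<Rightarrow> var set" where
  "all_vars_gliteral (Lit l) = vars_lit l"
| "all_vars_gliteral (Gen Ys \<phi> \<psi>) = vars_bform \<phi> \<union> vars_atom \<psi> \<union> set Ys"

definition vars_rule :: "('p, 'c) grule \<Rightarrow> var set" where
  "vars_rule r = \<Union> (vars_lit ` head r) \<union> \<Union> (free_vars_gliteral ` body r)"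

definition all_vars :: "('p, 'c) grule set \<Rightarrow> var set" where
  "all_vars P = (\<Union>r\<in>P. \<Union> (vars_lit ` head r) \<union> \<Union> (all_vars_gliteral ` body r))"

definition atoms_rule :: "('p, 'c) grule \<Rightarrow> ('p, 'c) atom set" where
  "atoms_rule r = \<Union> (set_lit ` head r) \<union> \<Union> (set_gliteral ` body r)"

definition constants :: "('p, 'c) grule set \<Rightarrow> 'c set" where
  "constants P = {c. \<exists>r\<in>P. \<exists>a\<in>atoms_rule r. Const c \<in> trms_atom a}"

text \<open>A predicate is a name together with an arity.\<close>

definition preds :: "('p, 'c) grule set \<Rightarrow> ('p \<times> nat) set" where
  "preds P = {(q, length ts) | q ts. \<exists>r\<in>P. Rel q ts \<in> atoms_rule r}"

definition is_rule :: "('p, 'c) grule \<Rightarrow> bool" where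
  "is_rule r \<longleftrightarrow> finite (head r) \<and> countable (body r) \<and> card (pos (head r)) \<le> 1
     \<and> (\<forall>s t. Equ s t \<notin> pos (head r))"

definition generalized_program :: "('p, 'c) grule set \<Rightarrow> bool" where
  "generalized_program P \<longleftrightarrow> finite P \<and> (\<forall>r\<in>P. is_rule r \<and> finite (body r))"

definition p_program :: "'p \<Rightarrow> nat \<Rightarrow> ('p, 'c) grule set \<Rightarrow> bool" where
  "p_program p n P \<longleftrightarrow> generalized_program P \<and> preds P \<subseteq> {(p, n)}"

definition universe :: "('p, 'c) grule set \<Rightarrow> 'c set \<Rightarrow> bool" where
  "universe P U \<longleftrightarrow> U \<noteq> {} \<and> countable U \<and> constants P \<subseteq> U"


section \<open>Grounding\<close>

text \<open>\<open>inst_trm A \<sigma>\<close> replaces the variables in \<open>A\<close>, and only those, by their values under \<open>\<sigma>\<close>.\<close>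

fun inst_trm :: "var set \<Rightarrow> (var \<Rightarrow> 'c) \<Rightarrow> 'c trm \<Rightarrow> 'c trm" where
  "inst_trm A \<sigma> (Var x) = (if x \<in> A then Const (\<sigma> x) else Var x)"
| "inst_trm A \<sigma> (Const c) = Const c"

fun inst_atom :: "var set \<Rightarrow> (var \<Rightarrow> 'c) \<Rightarrow> ('p, 'c) atom \<Rightarrow> ('p, 'c) atom" where
  "inst_atom A \<sigma> (Rel q ts) = Rel q (map (inst_trm A \<sigma>) ts)"
| "inst_atom A \<sigma> (Equ s t) = Equ (inst_trm A \<sigma> s) (inst_trm A \<sigma> t)"

abbreviation inst_lit :: "var set \<Rightarrow> (var \<Rightarrow> 'c) \<Rightarrow> ('p, 'c) atom lit \<Rightarrow> ('p, 'c) atom lit" where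
  "inst_lit A \<sigma> \<equiv> map_lit (inst_atom A \<sigma>)"

abbreviation inst_bform :: "var set \<Rightarrow> (var \<Rightarrow> 'c) \<Rightarrow> ('p, 'c) atom bform \<Rightarrow> ('p, 'c) atom bform" where
  "inst_bform A \<sigma> \<equiv> map_bform (inst_atom A \<sigma>)"

fun ground_gliteral :: "(var \<Rightarrow> 'c) \<Rightarrow> ('p, 'c) atom gliteral \<Rightarrow> ('p, 'c) atom gliteral" where
  "ground_gliteral \<sigma> (Lit l) = Lit (inst_lit UNIV \<sigma> l)"
| "ground_gliteral \<sigma> (Gen Ys \<phi> \<psi>) =
     Gen Ys (inst_bform (- set Ys) \<sigma> \<phi>) (inst_atom (- set Ys) \<sigma> \<psi>)"

definition ground_rule :: "(var \<Rightarrow> 'c) \<Rightarrow> ('p, 'c) grule \<Rightarrow> ('p, 'c) grule" where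
  "ground_rule \<sigma> r = Rule (inst_lit UNIV \<sigma> ` head r) (ground_gliteral \<sigma> ` body r)"

definition ground :: "'c set \<Rightarrow> ('p, 'c) grule set \<Rightarrow> ('p, 'c) grule set" where
  "ground U P = {ground_rule \<sigma> r | \<sigma> r. r \<in> P \<and> range \<sigma> \<subseteq> U}"


section \<open>Open answer sets\<close>

definition ground_atoms :: "('p \<times> nat) set \<Rightarrow> 'c set \<Rightarrow> ('p, 'c) atom set" where
  "ground_atoms Q U = {Rel q (map Const xs) | q xs. (q, length xs) \<in> Q \<and> set xs \<subseteq> U}"

text \<open>The following truth definitions are meant for ground arguments only.\<close>

fun holds_atom :: "('p, 'c) atom set \<Rightarrow> ('p, 'c) atom \<Rightarrow> bool" where
  "holds_atom I (Rel q ts) \<longleftrightarrow> Rel q ts \<in> I"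
| "holds_atom I (Equ s t) \<longleftrightarrow> s = t"

fun holds_lit :: "('p, 'c) atom set \<Rightarrow> ('p, 'c) atom lit \<Rightarrow> bool" where
  "holds_lit I (Pos a) \<longleftrightarrow> holds_atom I a"
| "holds_lit I (Naf a) \<longleftrightarrow> \<not> holds_atom I a"

fun holds_bform :: "('p, 'c) atom set \<Rightarrow> ('p, 'c) atom bform \<Rightarrow> bool" where
  "holds_bform I (BAtom a) \<longleftrightarrow> holds_atom I a"
| "holds_bform I (BNot \<phi>) \<longleftrightarrow> \<not> holds_bform I \<phi>"
| "holds_bform I (BAnd \<phi> \<psi>) \<longleftrightarrow> holds_bform I \<phi> \<and> holds_bform I \<psi>"
| "holds_bform I (BOr \<phi> \<psi>) \<longleftrightarrow> holds_bform I \<phi> \<or> holds_bform I \<psi>"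

definition geli_reduct ::
  "'c set \<Rightarrow> ('p, 'c) atom set \<Rightarrow> ('p, 'c) grule set \<Rightarrow> ('p, 'c) lrule set" where
  "geli_reduct U I Q =
     {Rule (head r)
        (lits (body r) \<union>
         {Pos (inst_atom (set Ys) \<sigma> \<psi>) | Ys \<phi> \<psi> \<sigma>.
            Gen Ys \<phi> \<psi> \<in> body r \<and> range \<sigma> \<subseteq> U \<and> holds_bform I (inst_bform (set Ys) \<sigma> \<phi>)})
      | r. r \<in> Q}"

definition satisfies :: "('p, 'c) atom set \<Rightarrow> ('p, 'c) lrule \<Rightarrow> bool" where
  "satisfies I r \<longleftrightarrow> (\<forall>l\<in>body r. holds_lit I l) \<longrightarrow> (\<exists>l\<in>head r. holds_lit I l)"

definition is_model :: "('p, 'c) atom set \<Rightarrow> ('p, 'c) lrule set \<Rightarrow> bool" where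
  "is_model I Q \<longleftrightarrow> (\<forall>r\<in>Q. satisfies I r)"

definition minimal_model :: "('p, 'c) atom set \<Rightarrow> ('p, 'c) lrule set \<Rightarrow> bool" where
  "minimal_model I Q \<longleftrightarrow> is_model I Q \<and> \<not> (\<exists>J. J \<subset> I \<and> is_model J Q)"

definition gl_reduct :: "('p, 'c) atom set \<Rightarrow> ('p, 'c) lrule set \<Rightarrow> ('p, 'c) lrule set" where
  "gl_reduct I Q =
     {Rule (Pos ` pos (head r)) (Pos ` pos (body r))
      | r. r \<in> Q \<and> (\<forall>a\<in>neg (body r). holds_lit I (Naf a)) \<and> (\<forall>a\<in>neg (head r). holds_atom I a)}"

text \<open>
  No separate clause is needed for programs without \<open>Naf\<close>: these coincide with their
  reduct \<open>gl_reduct I Q\<close>.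
\<close>

definition answer_set :: "('p, 'c) atom set \<Rightarrow> ('p, 'c) lrule set \<Rightarrow> bool" where
  "answer_set I Q \<longleftrightarrow> minimal_model I (gl_reduct I Q)"

definition open_answer_set ::
  "('p, 'c) grule set \<Rightarrow> 'c set \<Rightarrow> ('p, 'c) atom set \<Rightarrow> bool" where
  "open_answer_set P U M \<longleftrightarrow>
     universe P U \<and> M \<subseteq> ground_atoms (preds P) U \<and> answer_set M (geli_reduct U M (ground U P))"


section \<open>Fixed point logic\<close>

type_synonym pvar = nat

datatype ('q, 'c) fpl =
    FTrue
  | FFalse
  | FAtom "('q, 'c) atom"
  | FPVar pvar "'c trm list"
  | FNeg "('q, 'c) fpl"
  | FAnd "('q, 'c) fpl" "('q, 'c) fpl"
  | FOr "('q, 'c) fpl" "('q, 'c) fpl"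
  | FImp "('q, 'c) fpl" "('q, 'c) fpl"
  | FIff "('q, 'c) fpl" "('q, 'c) fpl"
  | FAll var "('q, 'c) fpl"
  | FEx var "('q, 'c) fpl"
  | FLfp pvar "var list" "('q, 'c) fpl" "'c trm list"
      \<comment> \<open>\<open>FLfp W Xs \<psi> ts\<close> is \<open>[LFP W Xs. \<psi>](ts)\<close>\<close>

fun val :: "(var \<Rightarrow> 'c) \<Rightarrow> 'c trm \<Rightarrow> 'c" where
  "val \<nu> (Var x) = \<nu> x"
| "val \<nu> (Const c) = c"

definition assign :: "(var \<Rightarrow> 'c) \<Rightarrow> var list \<Rightarrow> 'c list \<Rightarrow> var \<Rightarrow> 'c" where
  "assign \<nu> Xs xs = (\<lambda>v. case map_of (zip Xs xs) v of None \<Rightarrow> \<nu> v | Some x \<Rightarrow> x)"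

text \<open>\<open>V\<close> interprets the predicate variables.  Constants denote themselves.\<close>

fun sat :: "'c set \<Rightarrow> ('q, 'c) atom set \<Rightarrow> (pvar \<Rightarrow> 'c list set) \<Rightarrow> (var \<Rightarrow> 'c) \<Rightarrow> ('q, 'c) fpl \<Rightarrow> bool"
where
  "sat U N V \<nu> FTrue \<longleftrightarrow> True"
| "sat U N V \<nu> FFalse \<longleftrightarrow> False"
| "sat U N V \<nu> (FAtom a) \<longleftrightarrow> holds_atom N (inst_atom UNIV \<nu> a)"
| "sat U N V \<nu> (FPVar W ts) \<longleftrightarrow> map (val \<nu>) ts \<in> V W"
| "sat U N V \<nu> (FNeg f) \<longleftrightarrow> \<not> sat U N V \<nu> f"
| "sat U N V \<nu> (FAnd f g) \<longleftrightarrow> sat U N V \<nu> f \<and> sat U N V \<nu> g"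
| "sat U N V \<nu> (FOr f g) \<longleftrightarrow> sat U N V \<nu> f \<or> sat U N V \<nu> g"
| "sat U N V \<nu> (FImp f g) \<longleftrightarrow> (sat U N V \<nu> f \<longrightarrow> sat U N V \<nu> g)"
| "sat U N V \<nu> (FIff f g) \<longleftrightarrow> (sat U N V \<nu> f \<longleftrightarrow> sat U N V \<nu> g)"
| "sat U N V \<nu> (FAll x f) \<longleftrightarrow> (\<forall>c\<in>U. sat U N V (\<nu>(x := c)) f)"
| "sat U N V \<nu> (FEx x f) \<longleftrightarrow> (\<exists>c\<in>U. sat U N V (\<nu>(x := c)) f)"
| "sat U N V \<nu> (FLfp W Xs f ts) \<longleftrightarrow>
     map (val \<nu>) ts \<in>
       lfp (\<lambda>S. {xs. length xs = length Xs \<and> set xs \<subseteq> U \<and> sat U N (V(W := S)) (assign \<nu> Xs xs) f})"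

text \<open>Meant for sentences, whose truth does not depend on \<open>V\<close> and \<open>\<nu>\<close>.\<close>

definition models :: "'c set \<Rightarrow> ('q, 'c) atom set \<Rightarrow> ('q, 'c) fpl \<Rightarrow> bool" where
  "models U N f \<longleftrightarrow> (\<forall>V \<nu>. range \<nu> \<subseteq> U \<longrightarrow> sat U N V \<nu> f)"

definition alls :: "var list \<Rightarrow> ('q, 'c) fpl \<Rightarrow> ('q, 'c) fpl" where
  "alls Xs f = foldr FAll Xs f"

definition exs :: "var list \<Rightarrow> ('q, 'c) fpl \<Rightarrow> ('q, 'c) fpl" where
  "exs Xs f = foldr FEx Xs f"

definition list_of :: "'a set \<Rightarrow> 'a list" where
  "list_of A = (SOME xs. set xs = A \<and> distinct xs)"

definition conj_list :: "('q, 'c) fpl list \<Rightarrow> ('q, 'c) fpl" where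
  "conj_list fs = foldr FAnd fs FTrue"

definition disj_list :: "('q, 'c) fpl list \<Rightarrow> ('q, 'c) fpl" where
  "disj_list fs = foldr FOr fs FFalse"

text \<open>Conjunction and disjunction of a finite set of formulas, in an arbitrary order.\<close>

definition big_conj :: "('q, 'c) fpl set \<Rightarrow> ('q, 'c) fpl" where
  "big_conj F = conj_list (list_of F)"

definition big_disj :: "('q, 'c) fpl set \<Rightarrow> ('q, 'c) fpl" where
  "big_disj F = disj_list (list_of F)"

lemma set_list_of: "finite A \<Longrightarrow> set (list_of A) = A"
  unfolding list_of_def by (rule someI2_ex[OF finite_distinct_list]) auto

lemma sat_conj_list: "sat U N V \<nu> (conj_list fs) \<longleftrightarrow> (\<forall>f\<in>set fs. sat U N V \<nu> f)"
  unfolding conj_list_def by (induction fs) auto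

lemma sat_disj_list: "sat U N V \<nu> (disj_list fs) \<longleftrightarrow> (\<exists>f\<in>set fs. sat U N V \<nu> f)"
  unfolding disj_list_def by (induction fs) auto

lemma sat_conj: "finite F \<Longrightarrow> sat U N V \<nu> (big_conj F) \<longleftrightarrow> (\<forall>f\<in>F. sat U N V \<nu> f)"
  by (simp add: big_conj_def sat_conj_list set_list_of)

lemma sat_disj: "finite F \<Longrightarrow> sat U N V \<nu> (big_disj F) \<longleftrightarrow> (\<exists>f\<in>F. sat U N V \<nu> f)"
  by (simp add: big_disj_def sat_disj_list set_list_of)


subsection \<open>Well-formed formulas\<close>

fun fv :: "('q, 'c) fpl \<Rightarrow> var set" where
  "fv FTrue = {}"
| "fv FFalse = {}"
| "fv (FAtom a) = vars_atom a"
| "fv (FPVar W ts) = \<Union> (vars_trm ` set ts)"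
| "fv (FNeg f) = fv f"
| "fv (FAnd f g) = fv f \<union> fv g"
| "fv (FOr f g) = fv f \<union> fv g"
| "fv (FImp f g) = fv f \<union> fv g"
| "fv (FIff f g) = fv f \<union> fv g"
| "fv (FAll x f) = fv f - {x}"
| "fv (FEx x f) = fv f - {x}"
| "fv (FLfp W Xs f ts) = (fv f - set Xs) \<union> \<Union> (vars_trm ` set ts)"

text \<open>\<open>W\<close> occurs only with polarity \<open>b\<close> (positively for \<open>True\<close>).\<close>

fun polar :: "bool \<Rightarrow> pvar \<Rightarrow> ('q, 'c) fpl \<Rightarrow> bool" where
  "polar b W (FPVar W' ts) \<longleftrightarrow> (W' = W \<longrightarrow> b)"
| "polar b W (FNeg f) \<longleftrightarrow> polar (\<not> b) W f"
| "polar b W (FAnd f g) \<longleftrightarrow> polar b W f \<and> polar b W g"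
| "polar b W (FOr f g) \<longleftrightarrow> polar b W f \<and> polar b W g"
| "polar b W (FImp f g) \<longleftrightarrow> polar (\<not> b) W f \<and> polar b W g"
| "polar b W (FIff f g) \<longleftrightarrow> (\<forall>c. polar c W f \<and> polar c W g)"
| "polar b W (FAll x f) \<longleftrightarrow> polar b W f"
| "polar b W (FEx x f) \<longleftrightarrow> polar b W f"
| "polar b W (FLfp W' Xs f ts) \<longleftrightarrow> (W' \<noteq> W \<longrightarrow> polar b W f)"
| "polar b W _ \<longleftrightarrow> True"

fun fpl_wf :: "('q, 'c) fpl \<Rightarrow> bool" where
  "fpl_wf (FNeg f) \<longleftrightarrow> fpl_wf f"
| "fpl_wf (FAnd f g) \<longleftrightarrow> fpl_wf f \<and> fpl_wf g"
| "fpl_wf (FOr f g) \<longleftrightarrow> fpl_wf f \<and> fpl_wf g"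
| "fpl_wf (FImp f g) \<longleftrightarrow> fpl_wf f \<and> fpl_wf g"
| "fpl_wf (FIff f g) \<longleftrightarrow> fpl_wf f \<and> fpl_wf g"
| "fpl_wf (FAll x f) \<longleftrightarrow> fpl_wf f"
| "fpl_wf (FEx x f) \<longleftrightarrow> fpl_wf f"
| "fpl_wf (FLfp W Xs f ts) \<longleftrightarrow>
     fpl_wf f \<and> polar True W f \<and> fv f \<subseteq> set Xs \<and> length ts = length Xs \<and> distinct Xs"
| "fpl_wf _ \<longleftrightarrow> True"

section \<open>The completion\<close>

text \<open>
  Rules and generalized literals serve as their own names, so that names are unique; the
  constructors keep the new predicate symbols apart from those of the program.
\<close>

datatype ('p, 'c) sym =
    Orig 'p
  | RuleName "('p, 'c) grule"
  | GenName "('p, 'c) atom gliteral"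

definition lift_atom :: "('p, 'c) atom \<Rightarrow> (('p, 'c) sym, 'c) atom" where
  "lift_atom = map_atom Orig id"

definition rule_atom :: "('p, 'c) grule \<Rightarrow> (('p, 'c) sym, 'c) atom" where
  "rule_atom r = Rel (RuleName r) (map Var (sorted_list_of_set (vars_rule r)))"

text \<open>\<open>gen_atom Ys \<phi> \<psi>\<close> is \<open>g(Z)\<close> for \<open>g : \<forall>Ys. \<phi> \<Rightarrow> \<psi>\<close>, with \<open>Z\<close> all variables of \<open>\<phi>\<close>.\<close>

definition gen_atom ::
  "var list \<Rightarrow> ('p, 'c) atom bform \<Rightarrow> ('p, 'c) atom \<Rightarrow> (('p, 'c) sym, 'c) atom" where
  "gen_atom Ys \<phi> \<psi> =
     Rel (GenName (Gen Ys \<phi> \<psi>)) (map Var (sorted_list_of_set (vars_bform \<phi>)))"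

definition fo_atom :: "('p, 'c) atom \<Rightarrow> (('p, 'c) sym, 'c) fpl" where
  "fo_atom a = FAtom (lift_atom a)"

fun fo_lit :: "('p, 'c) atom lit \<Rightarrow> (('p, 'c) sym, 'c) fpl" where
  "fo_lit (Pos a) = fo_atom a"
| "fo_lit (Naf a) = FNeg (fo_atom a)"

fun fo_bform :: "('p, 'c) atom bform \<Rightarrow> (('p, 'c) sym, 'c) fpl" where
  "fo_bform (BAtom a) = fo_atom a"
| "fo_bform (BNot \<phi>) = FNeg (fo_bform \<phi>)"
| "fo_bform (BAnd \<phi> \<psi>) = FAnd (fo_bform \<phi>) (fo_bform \<psi>)"
| "fo_bform (BOr \<phi> \<psi>) = FOr (fo_bform \<phi>) (fo_bform \<psi>)"

fun fo_gliteral :: "('p, 'c) atom gliteral \<Rightarrow> (('p, 'c) sym, 'c) fpl" where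
  "fo_gliteral (Lit l) = fo_lit l"
| "fo_gliteral (Gen Ys \<phi> \<psi>) = alls Ys (FImp (fo_bform \<phi>) (fo_atom \<psi>))"

text \<open>\<open>repl_atom p W a\<close> is \<open>a[p|W]\<close>, and \<open>repl_gen p W g\<close> is the element of \<open>\<gamma>\<close> obtained from \<open>g\<close>.\<close>

fun repl_atom :: "'p \<Rightarrow> pvar \<Rightarrow> ('p, 'c) atom \<Rightarrow> (('p, 'c) sym, 'c) fpl" where
  "repl_atom p W (Rel q ts) = (if q = p then FPVar W ts else fo_atom (Rel q ts))"
| "repl_atom p W (Equ s t) = fo_atom (Equ s t)"

definition repl_gen ::
  "'p \<Rightarrow> pvar \<Rightarrow> var list \<Rightarrow> ('p, 'c) atom bform \<Rightarrow> ('p, 'c) atom \<Rightarrow> (('p, 'c) sym, 'c) fpl" where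
  "repl_gen p W Ys \<phi> \<psi> = alls Ys (FImp (FAtom (gen_atom Ys \<phi> \<psi>)) (repl_atom p W \<psi>))"

definition E_formula ::
  "'p \<Rightarrow> pvar \<Rightarrow> var list \<Rightarrow> 'c trm list \<Rightarrow> ('p, 'c) grule \<Rightarrow> (('p, 'c) sym, 'c) fpl" where
  "E_formula p W Xs ts r =
     exs (sorted_list_of_set (vars_rule r))
       (conj_list
          [conj_list (map2 (\<lambda>X t. FAtom (Equ (Var X) t)) Xs ts),
           big_conj (repl_atom p W ` pos (lits (body r))),
           big_conj {repl_gen p W Ys \<phi> \<psi> | Ys \<phi> \<psi>. Gen Ys \<phi> \<psi> \<in> body r},
           FAtom (rule_atom r)])"

definition phi_formula ::
  "'p \<Rightarrow> pvar \<Rightarrow> var list \<Rightarrow> ('p, 'c) grule set \<Rightarrow> (('p, 'c) sym, 'c) fpl" where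
  "phi_formula p W Xs P =
     FOr (FPVar W (map Var Xs))
       (big_disj {E_formula p W Xs ts r | ts r. r \<in> P \<and> Rel p ts \<in> pos (head r)})"

text \<open>\<open>Xs\<close> are the new variables \<open>X\<^sub>1, \<dots>, X\<^sub>n\<close>.\<close>

definition compgl :: "'p \<Rightarrow> var list \<Rightarrow> ('p, 'c) grule set \<Rightarrow> (('p, 'c) sym, 'c) fpl set" where
  "compgl p Xs P =
     {FNeg (FAtom (Equ (Const a) (Const b))) | a b. a \<in> constants P \<and> b \<in> constants P \<and> a \<noteq> b} \<union>
     {FEx 0 FTrue} \<union>
     {alls (sorted_list_of_set (vars_rule r))
        (FImp (big_conj (fo_gliteral ` body r)) (big_disj (fo_lit ` head r))) | r. r \<in> P} \<union>
     {alls (sorted_list_of_set (vars_rule r))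
        (FIff (FAtom (rule_atom r))
           (FAnd (big_conj (fo_atom ` neg (head r)))
                 (big_conj ((\<lambda>a. FNeg (fo_atom a)) ` neg (lits (body r)))))) | r. r \<in> P} \<union>
     {alls (sorted_list_of_set (vars_bform \<phi>))
        (FIff (FAtom (gen_atom Ys \<phi> \<psi>)) (fo_bform \<phi>)) | Ys \<phi> \<psi>. \<exists>r\<in>P. Gen Ys \<phi> \<psi> \<in> body r} \<union>
     {alls Xs
        (FImp (FAtom (Rel (Orig p) (map Var Xs)))
              (FLfp 0 Xs (phi_formula p 0 Xs P) (map Var Xs)))}"

text \<open>
  The sets \<open>R\<close> and \<open>G\<close> of true atoms over the new predicates.  Instantiating \<open>rule_atom r\<close>
  with \<open>\<sigma>\<close> gives \<open>r(\<sigma> Y)\<close>, where \<open>Y\<close> lists \<open>vars_rule r\<close>; likewise for \<open>gen_atom\<close>.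
\<close>

definition R_set ::
  "('p, 'c) grule set \<Rightarrow> 'c set \<Rightarrow> ('p, 'c) atom set \<Rightarrow> (('p, 'c) sym, 'c) atom set" where
  "R_set P U M =
     {inst_atom UNIV \<sigma> (rule_atom r) | r \<sigma>. r \<in> P \<and> range \<sigma> \<subseteq> U \<and>
        (\<forall>a \<in> neg (head (ground_rule \<sigma> r)). holds_atom M a) \<and>
        (\<forall>a \<in> neg (lits (body (ground_rule \<sigma> r))). holds_lit M (Naf a))}"

definition G_set ::
  "('p, 'c) grule set \<Rightarrow> 'c set \<Rightarrow> ('p, 'c) atom set \<Rightarrow> (('p, 'c) sym, 'c) atom set" where
  "G_set P U M =
     {inst_atom UNIV \<sigma> (gen_atom Ys \<phi> \<psi>) | Ys \<phi> \<psi> \<sigma>.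
        (\<exists>r\<in>P. Gen Ys \<phi> \<psi> \<in> body r) \<and> range \<sigma> \<subseteq> U \<and> holds_bform M (inst_bform UNIV \<sigma> \<phi>)}"


subsection \<open>The completion consists of finitely many well-formed sentences\<close>

lemma finite_vars_trm: "finite (vars_trm t)"
  by (cases t) auto

lemma finite_trms_atom: "finite (trms_atom a)"
  by (cases a) auto

lemma finite_vars_atom: "finite (vars_atom a)"
  by (simp add: vars_atom_def finite_trms_atom finite_vars_trm)

lemma finite_set_lit: "finite (set_lit l)"
  by (cases l) auto

lemma finite_set_bform: "finite (set_bform \<phi>)"
  by (induction \<phi>) auto

lemma finite_vars_bform: "finite (vars_bform \<phi>)"
  by (simp add: vars_bform_def finite_set_bform finite_vars_atom)

lemma finite_vars_lit: "finite (vars_lit l)"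
  by (simp add: vars_lit_def finite_set_lit finite_vars_atom)

lemma finite_free_vars_gliteral: "finite (free_vars_gliteral g)"
  by (cases g) (auto simp: finite_vars_lit finite_vars_bform finite_vars_atom)

lemma finite_set_gliteral: "finite (set_gliteral g)"
  by (cases g) (auto simp: finite_set_lit finite_set_bform)

lemma finite_vars_rule: "finite (head r) \<Longrightarrow> finite (body r) \<Longrightarrow> finite (vars_rule r)"
  by (simp add: vars_rule_def finite_vars_lit finite_free_vars_gliteral)

lemma finite_atoms_rule: "finite (head r) \<Longrightarrow> finite (body r) \<Longrightarrow> finite (atoms_rule r)"
  by (simp add: atoms_rule_def finite_set_lit finite_set_gliteral)

lemma finite_pos: "finite A \<Longrightarrow> finite (pos A)"
  unfolding pos_def by (rule finite_subset[of _ "\<Union> (set_lit ` A)"]) (force simp: finite_set_lit)+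

lemma finite_neg: "finite A \<Longrightarrow> finite (neg A)"
  unfolding neg_def by (rule finite_subset[of _ "\<Union> (set_lit ` A)"]) (force simp: finite_set_lit)+

lemma finite_lits: "finite B \<Longrightarrow> finite (lits B)"
  unfolding lits_def by (rule finite_vimageI[of B Lit, unfolded vimage_def]) (auto simp: inj_def)

lemma finite_gen_image:
  assumes "finite B" shows "finite {F Ys \<phi> \<psi> | Ys \<phi> \<psi>. Gen Ys \<phi> \<psi> \<in> B}"
  by (rule finite_subset[of _ "(\<lambda>g. case g of Gen Ys \<phi> \<psi> \<Rightarrow> F Ys \<phi> \<psi> | _ \<Rightarrow> undefined) ` B"])
     (use assms in \<open>force+\<close>)

lemma finite_E_formulas:
  assumes "generalized_program P"
  shows "finite {E_formula p W Xs ts r | ts r. r \<in> P \<and> Rel p ts \<in> pos (head r)}"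
proof -
  have "finite (\<Union>r\<in>P. (\<lambda>a. case a of Rel q ts \<Rightarrow> E_formula p W Xs ts r | _ \<Rightarrow> undefined) ` pos (head r))"
    using assms by (auto simp: generalized_program_def is_rule_def finite_pos)
  then show ?thesis
    by (rule rev_finite_subset) force
qed

lemma finite_constants:
  assumes "generalized_program P" shows "finite (constants P)"
proof -
  have "finite (\<Union>r\<in>P. \<Union>a\<in>atoms_rule r. {c. Const c \<in> trms_atom a})"
    using assms
    by (auto simp: generalized_program_def is_rule_def finite_atoms_rule
        intro!: finite_vimageI[of "trms_atom _" Const, unfolded vimage_def] finite_trms_atom injI)
  then show ?thesis
    by (rule rev_finite_subset) (auto simp: constants_def)
qed

lemma finite_compgl:
  assumes P: "generalized_program P"
  shows "finite (compgl p Xs P)"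
proof -
  have fP: "finite P" and fB: "\<And>r. r \<in> P \<Longrightarrow> finite (body r)"
    using P by (auto simp: generalized_program_def)
  have "finite {FNeg (FAtom (Equ (Const a) (Const b))) | a b. a \<in> constants P \<and> b \<in> constants P \<and> a \<noteq> b}"
    by (rule finite_subset[of _ "(\<lambda>(a, b). FNeg (FAtom (Equ (Const a) (Const b)))) ` (constants P \<times> constants P)"])
       (auto simp: finite_constants[OF P])
  moreover have "finite {alls (sorted_list_of_set (vars_bform \<phi>))
        (FIff (FAtom (gen_atom Ys \<phi> \<psi>)) (fo_bform \<phi>)) | Ys \<phi> \<psi>. \<exists>r\<in>P. Gen Ys \<phi> \<psi> \<in> body r}"
    using finite_gen_image[of "\<Union> (body ` P)" "\<lambda>Ys \<phi> \<psi>. alls (sorted_list_of_set (vars_bform \<phi>))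
        (FIff (FAtom (gen_atom Ys \<phi> \<psi>)) (fo_bform \<phi>))"] fP fB by auto
  ultimately show ?thesis
    unfolding compgl_def using fP by simp
qed

lemma fv_alls: "fv (alls Xs f) = fv f - set Xs"
  unfolding alls_def by (induction Xs) auto

lemma fv_exs: "fv (exs Xs f) = fv f - set Xs"
  unfolding exs_def by (induction Xs) auto

lemma fv_conj_list: "fv (conj_list fs) = \<Union> (fv ` set fs)"
  unfolding conj_list_def by (induction fs) auto

lemma fv_disj_list: "fv (disj_list fs) = \<Union> (fv ` set fs)"
  unfolding disj_list_def by (induction fs) auto

lemma fv_conj: "finite F \<Longrightarrow> fv (big_conj F) = \<Union> (fv ` F)"
  by (simp add: big_conj_def fv_conj_list set_list_of)

lemma fv_disj: "finite F \<Longrightarrow> fv (big_disj F) = \<Union> (fv ` F)"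
  by (simp add: big_disj_def fv_disj_list set_list_of)

lemma wf_alls: "fpl_wf (alls Xs f) = fpl_wf f"
  unfolding alls_def by (induction Xs) auto

lemma wf_exs: "fpl_wf (exs Xs f) = fpl_wf f"
  unfolding exs_def by (induction Xs) auto

lemma wf_conj_list: "fpl_wf (conj_list fs) \<longleftrightarrow> (\<forall>f\<in>set fs. fpl_wf f)"
  unfolding conj_list_def by (induction fs) auto

lemma wf_disj_list: "fpl_wf (disj_list fs) \<longleftrightarrow> (\<forall>f\<in>set fs. fpl_wf f)"
  unfolding disj_list_def by (induction fs) auto

lemma wf_conj: "finite F \<Longrightarrow> fpl_wf (big_conj F) \<longleftrightarrow> (\<forall>f\<in>F. fpl_wf f)"
  by (simp add: big_conj_def wf_conj_list set_list_of)

lemma wf_disj: "finite F \<Longrightarrow> fpl_wf (big_disj F) \<longleftrightarrow> (\<forall>f\<in>F. fpl_wf f)"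
  by (simp add: big_disj_def wf_disj_list set_list_of)

lemma polar_alls: "polar b W (alls Xs f) = polar b W f"
  unfolding alls_def by (induction Xs) auto

lemma polar_exs: "polar b W (exs Xs f) = polar b W f"
  unfolding exs_def by (induction Xs) auto

lemma polar_conj_list: "polar b W (conj_list fs) \<longleftrightarrow> (\<forall>f\<in>set fs. polar b W f)"
  unfolding conj_list_def by (induction fs) auto

lemma polar_disj_list: "polar b W (disj_list fs) \<longleftrightarrow> (\<forall>f\<in>set fs. polar b W f)"
  unfolding disj_list_def by (induction fs) auto

lemma polar_conj: "finite F \<Longrightarrow> polar b W (big_conj F) \<longleftrightarrow> (\<forall>f\<in>F. polar b W f)"
  by (simp add: big_conj_def polar_conj_list set_list_of)

lemma polar_disj: "finite F \<Longrightarrow> polar b W (big_disj F) \<longleftrightarrow> (\<forall>f\<in>F. polar b W f)"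
  by (simp add: big_disj_def polar_disj_list set_list_of)

lemma vars_lift_atom: "vars_atom (lift_atom a) = vars_atom a"
proof -
  have "map_trm id t = t" for t :: "'b trm" by (cases t) auto
  then show ?thesis by (cases a) (auto simp: vars_atom_def lift_atom_def)
qed

lemma fv_fo_atom: "fv (fo_atom a) = vars_atom a"
  by (simp add: fo_atom_def vars_lift_atom)

lemma fv_fo_lit: "fv (fo_lit l) = vars_lit l"
  by (cases l) (auto simp: fv_fo_atom vars_lit_def)

lemma fv_fo_bform: "fv (fo_bform \<phi>) = vars_bform \<phi>"
  by (induction \<phi>) (auto simp: fv_fo_atom vars_bform_def)

lemma fv_fo_gliteral: "fv (fo_gliteral g) = free_vars_gliteral g"
  by (cases g) (auto simp: fv_fo_lit fv_alls fv_fo_bform fv_fo_atom)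

lemma fv_repl_atom: "fv (repl_atom p W a) = vars_atom a"
  by (cases a) (auto simp: fv_fo_atom, auto simp: vars_atom_def)

lemma fv_rule_atom: "finite (vars_rule r) \<Longrightarrow> vars_atom (rule_atom r) = vars_rule r"
  by (auto simp: vars_atom_def rule_atom_def)

lemma fv_gen_atom: "vars_atom (gen_atom Ys \<phi> \<psi>) = vars_bform \<phi>"
  by (auto simp: vars_atom_def gen_atom_def finite_vars_bform)

lemma fv_repl_gen: "fv (repl_gen p W Ys \<phi> \<psi>) = free_vars_gliteral (Gen Ys \<phi> \<psi>)"
  by (auto simp: repl_gen_def fv_alls fv_repl_atom fv_gen_atom)

lemma wf_fo_lit: "fpl_wf (fo_lit l)"
  by (cases l) (auto simp: fo_atom_def)

lemma wf_fo_bform: "fpl_wf (fo_bform \<phi>)"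
  by (induction \<phi>) (auto simp: fo_atom_def)

lemma wf_fo_gliteral: "fpl_wf (fo_gliteral g)"
  by (cases g) (auto simp: wf_fo_lit wf_alls wf_fo_bform fo_atom_def)

lemma wf_repl_atom: "fpl_wf (repl_atom p W a)"
  by (cases a) (auto simp: fo_atom_def)

lemma polar_repl_atom: "polar True W (repl_atom p W a)"
  by (cases a) (auto simp: fo_atom_def)

lemma wf_repl_gen: "fpl_wf (repl_gen p W Ys \<phi> \<psi>)"
  by (simp add: repl_gen_def wf_alls wf_repl_atom)

lemma polar_repl_gen: "polar True W (repl_gen p W Ys \<phi> \<psi>)"
  by (simp add: repl_gen_def polar_alls polar_repl_atom)

lemma E_formula_props:
  assumes fin: "finite (head r)" "finite (body r)" and ts: "Rel p ts \<in> pos (head r)"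
  shows "fv (E_formula p W Xs ts r) \<subseteq> set Xs" "fpl_wf (E_formula p W Xs ts r)"
    "polar True W (E_formula p W Xs ts r)"
proof -
  note f = finite_vars_rule[OF fin] finite_imageI[OF finite_pos[OF finite_lits[OF fin(2)]]]
    finite_gen_image[OF fin(2), of "repl_gen p W"]
  have 1: "vars_trm t \<subseteq> vars_rule r" if "t \<in> set ts" for t
    using ts that by (force simp: vars_rule_def vars_lit_def vars_atom_def pos_def)
  have 2: "vars_atom a \<subseteq> vars_rule r" if "a \<in> pos (lits (body r))" for a
    using that by (force simp: vars_rule_def vars_lit_def pos_def lits_def)
  have 3: "free_vars_gliteral g \<subseteq> vars_rule r" if "g \<in> body r" for g
    using that by (auto simp: vars_rule_def)
  have "X \<in> set Xs" if "(X, t) \<in> set (zip Xs ts)" for X t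
    using that by (rule set_zip_leftD)
  moreover have "vars_trm t \<subseteq> vars_rule r" if "(X, t) \<in> set (zip Xs ts)" for X t
    using 1[OF set_zip_rightD[OF that]] .
  ultimately have 4: "fv (conj_list (map2 (\<lambda>X t. FAtom (Equ (Var X) t)) Xs ts)) \<subseteq> set Xs \<union> vars_rule r"
    by (force simp: fv_conj_list vars_atom_def)
  have 5: "fv (big_conj (repl_atom p W ` pos (lits (body r)))) \<subseteq> vars_rule r"
    using 2 by (auto simp: fv_conj f fv_repl_atom)
  have 6: "fv (big_conj {repl_gen p W Ys \<phi> \<psi> | Ys \<phi> \<psi>. Gen Ys \<phi> \<psi> \<in> body r}) \<subseteq> vars_rule r"
  proof -
    have "fv h \<subseteq> vars_rule r" if "h \<in> {repl_gen p W Ys \<phi> \<psi> | Ys \<phi> \<psi>. Gen Ys \<phi> \<psi> \<in> body r}" for h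
    proof -
      obtain Ys \<phi> \<psi> where h: "h = repl_gen p W Ys \<phi> \<psi>" "Gen Ys \<phi> \<psi> \<in> body r"
        using \<open>h \<in> _\<close> by auto
      show ?thesis
        unfolding h(1) fv_repl_gen by (rule 3[OF h(2)])
    qed
    then show ?thesis
      unfolding fv_conj[OF f(3)] by (rule UN_least)
  qed
  show "fv (E_formula p W Xs ts r) \<subseteq> set Xs"
    unfolding E_formula_def fv_exs using 4 5 6
    by (auto simp: fv_conj_list f(1) fv_rule_atom)
  show "fpl_wf (E_formula p W Xs ts r)"
    unfolding E_formula_def
    by (auto simp: wf_exs wf_conj_list wf_conj f wf_repl_atom wf_repl_gen)
  show "polar True W (E_formula p W Xs ts r)"
    unfolding E_formula_def
    by (auto simp: polar_exs polar_conj_list polar_conj f polar_repl_atom polar_repl_gen)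
qed

lemma vars_neg_head: "a \<in> neg (head r) \<Longrightarrow> x \<in> vars_atom a \<Longrightarrow> x \<in> vars_rule r"
  by (force simp: vars_rule_def vars_lit_def neg_def)

lemma vars_neg_body: "a \<in> neg (lits (body r)) \<Longrightarrow> x \<in> vars_atom a \<Longrightarrow> x \<in> vars_rule r"
  by (force simp: vars_rule_def vars_lit_def neg_def lits_def)

lemma wf_compgl:
  assumes P: "generalized_program P" and Xs: "distinct Xs" and f: "f \<in> compgl p Xs P"
  shows "fpl_wf f" and "fv f = {}"
proof -
  have fin: "finite (head r)" "finite (body r)" if "r \<in> P" for r
    using P that by (auto simp: generalized_program_def is_rule_def)
  have phi: "fv (phi_formula p 0 Xs P) \<subseteq> set Xs \<and> fpl_wf (phi_formula p 0 Xs P)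
      \<and> polar True 0 (phi_formula p 0 Xs P)"
    using E_formula_props[OF fin]
    by (fastforce simp: phi_formula_def fv_disj wf_disj polar_disj finite_E_formulas[OF P])
  note simps = wf_alls wf_conj wf_disj fv_alls fv_conj fv_disj fin finite_neg finite_lits
    finite_vars_rule finite_vars_bform fv_rule_atom fv_gen_atom fv_fo_lit fv_fo_gliteral
    fv_fo_bform fv_fo_atom wf_fo_lit wf_fo_gliteral wf_fo_bform
  show "fpl_wf f"
    using f phi Xs by (auto simp: compgl_def simps fo_atom_def)
  have 1: "fv f = {}" if "r \<in> P" "f = alls (sorted_list_of_set (vars_rule r))
        (FImp (big_conj (fo_gliteral ` body r)) (big_disj (fo_lit ` head r)))" for r
    using that by (auto simp: simps) (auto simp: vars_rule_def)
  have 2: "fv f = {}" if "r \<in> P" "f = alls (sorted_list_of_set (vars_rule r))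
        (FIff (FAtom (rule_atom r)) (FAnd (big_conj (fo_atom ` neg (head r)))
                 (big_conj ((\<lambda>a. FNeg (fo_atom a)) ` neg (lits (body r))))))" for r
    using that by (auto simp: simps dest: vars_neg_head vars_neg_body)
  show "fv f = {}"
    using f[unfolded compgl_def]
  proof (elim UnE)
    assume "f \<in> {alls (sorted_list_of_set (vars_rule r))
        (FImp (big_conj (fo_gliteral ` body r)) (big_disj (fo_lit ` head r))) | r. r \<in> P}"
    then show ?thesis using 1 by blast
  next
    assume "f \<in> {alls (sorted_list_of_set (vars_rule r))
        (FIff (FAtom (rule_atom r))
           (FAnd (big_conj (fo_atom ` neg (head r)))
                 (big_conj ((\<lambda>a. FNeg (fo_atom a)) ` neg (lits (body r)))))) | r. r \<in> P}"
    then show ?thesis using 2 by blast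
  next
    assume "f \<in> {FNeg (FAtom (Equ (Const a) (Const b))) | a b.
      a \<in> constants P \<and> b \<in> constants P \<and> a \<noteq> b}"
    then show ?thesis by (auto simp: vars_atom_def)
  next
    assume "f \<in> {alls Xs
        (FImp (FAtom (Rel (Orig p) (map Var Xs)))
              (FLfp 0 Xs (phi_formula p 0 Xs P) (map Var Xs)))}"
    then show ?thesis using phi by (auto simp: fv_alls vars_atom_def)
  qed (auto simp: simps)
qed

end

theory Submission
  imports Defs
begin

text \<open>
  Every sentence of the completion except the rules themselves and the fixed point sentence holds
  by the choice of \<open>R\<close> and \<open>G\<close>.  The rules say that \<open>M\<close> is a model of the reduct.  The fixed point
  sentence says that \<open>M\<close> is contained in the least fixed point \<open>L\<close> of the immediate consequence
  operator of the reduct.  If \<open>M\<close> is a minimal model, then \<open>M \<inter> L\<close> is also a model, so \<open>M \<subseteq> L\<close>.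
  Conversely, every model \<open>J \<subseteq> M\<close> is closed under the operator because heads contain at most one
  positive atom; so \<open>M \<subseteq> L \<subseteq> J\<close>.
\<close>

section \<open>Grounding and valuations\<close>

lemma inst_trm_UNIV: "inst_trm UNIV \<sigma> t = Const (val \<sigma> t)"
  by (cases t) auto

lemma inst_atom_UNIV_Rel: "inst_atom UNIV \<sigma> (Rel q ts) = Rel q (map Const (map (val \<sigma>) ts))"
  by (simp add: inst_trm_UNIV)

lemma inst_atom_cong:
  assumes "\<And>x. x \<in> vars_atom a \<Longrightarrow> \<sigma> x = \<tau> x"
  shows "inst_atom A \<sigma> a = inst_atom A \<tau> a"
proof -
  have "inst_trm A \<sigma> t = inst_trm A \<tau> t" if "t \<in> trms_atom a" for t
    using assms that by (cases t) (force simp: vars_atom_def)+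
  then show ?thesis by (cases a) auto
qed

lemma inst_bform_cong:
  assumes "\<And>x. x \<in> vars_bform \<phi> \<Longrightarrow> \<sigma> x = \<tau> x"
  shows "inst_bform A \<sigma> \<phi> = inst_bform A \<tau> \<phi>"
  by (rule bform.map_cong[OF refl]) (rule inst_atom_cong, use assms in \<open>auto simp: vars_bform_def\<close>)

text \<open>A generalized literal is grounded in two stages: its free variables together with the
  rule, its quantified ones by the GeLi-reduct. Only constants are substituted, so nothing is
  captured and both stages amount to one valuation.\<close>

lemma inst_atom_inst_atom:
  "inst_atom A \<tau> (inst_atom (- A) \<sigma> a) = inst_atom UNIV (\<lambda>x. if x \<in> A then \<tau> x else \<sigma> x) a"
proof -
  have "inst_trm A \<tau> (inst_trm (- A) \<sigma> t) = inst_trm UNIV (\<lambda>x. if x \<in> A then \<tau> x else \<sigma> x) t" for t :: "'b trm"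
    by (cases t) auto
  then show ?thesis by (cases a) auto
qed

lemma inst_bform_inst_bform:
  "inst_bform A \<tau> (inst_bform (- A) \<sigma> \<phi>) = inst_bform UNIV (\<lambda>x. if x \<in> A then \<tau> x else \<sigma> x) \<phi>"
  by (simp add: bform.map_comp comp_def inst_atom_inst_atom)

section \<open>Literals and generalized literals of ground rules\<close>

lemma pos_inst_lit: "pos (inst_lit A \<sigma> ` L) = inst_atom A \<sigma> ` pos L"
proof -
  have "Pos a = inst_lit A \<sigma> l \<longleftrightarrow> (\<exists>b. l = Pos b \<and> a = inst_atom A \<sigma> b)" for a l
    by (cases l) auto
  then show ?thesis by (auto simp: pos_def image_iff)
qed

lemma neg_inst_lit: "neg (inst_lit A \<sigma> ` L) = inst_atom A \<sigma> ` neg L"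
proof -
  have "Naf a = inst_lit A \<sigma> l \<longleftrightarrow> (\<exists>b. l = Naf b \<and> a = inst_atom A \<sigma> b)" for a l
    by (cases l) auto
  then show ?thesis by (auto simp: neg_def image_iff)
qed

lemma lits_ground_gliteral: "lits (ground_gliteral \<sigma> ` B) = inst_lit UNIV \<sigma> ` lits B"
proof -
  have "Lit l = ground_gliteral \<sigma> g \<longleftrightarrow> (\<exists>k. g = Lit k \<and> l = inst_lit UNIV \<sigma> k)" for l g
    by (cases g) auto
  then show ?thesis by (auto simp: lits_def image_iff)
qed

text \<open>Grounding may identify different generalized literals, so a preimage is only asserted to
  exist; the quantified list \<open>Ys\<close> stays unchanged.\<close>

lemma Gen_mem_ground_gliteral:
  "Gen Ys \<phi> \<psi> \<in> ground_gliteral \<sigma> ` B \<longleftrightarrow>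
    (\<exists>\<phi>' \<psi>'. Gen Ys \<phi>' \<psi>' \<in> B \<and> \<phi> = inst_bform (- set Ys) \<sigma> \<phi>' \<and> \<psi> = inst_atom (- set Ys) \<sigma> \<psi>')"
proof -
  have "Gen Ys \<phi> \<psi> = ground_gliteral \<sigma> g \<longleftrightarrow>
      (\<exists>\<phi>' \<psi>'. g = Gen Ys \<phi>' \<psi>' \<and> \<phi> = inst_bform (- set Ys) \<sigma> \<phi>' \<and> \<psi> = inst_atom (- set Ys) \<sigma> \<psi>')" for g
    by (cases g) auto
  then show ?thesis by (auto simp: image_iff)
qed

lemma pos_Un: "pos (A \<union> B) = pos A \<union> pos B"
  by (auto simp: pos_def)

lemma neg_Un: "neg (A \<union> B) = neg A \<union> neg B"
  by (auto simp: neg_def)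

section \<open>Models of the reduct\<close>

text \<open>This is the condition for the instance of \<open>r\<close> under \<open>\<sigma>\<close>
  to survive the Gelfond-Lifschitz reduct by \<open>M\<close>. The completion expresses it by the
  atom \<open>rule_atom r\<close>.\<close>

definition naf_ok :: "('p, 'c) atom set \<Rightarrow> ('p, 'c) grule \<Rightarrow> (var \<Rightarrow> 'c) \<Rightarrow> bool" where
  "naf_ok M r \<sigma> \<longleftrightarrow>
     (\<forall>a\<in>neg (head r). holds_atom M (inst_atom UNIV \<sigma> a)) \<and>
     (\<forall>a\<in>neg (lits (body r)). \<not> holds_atom M (inst_atom UNIV \<sigma> a))"

text \<open>
  As in the reduct, the antecedents of generalized literals are evaluated in \<open>M\<close>,
  everything else in \<open>J\<close>.
\<close>

definition supported ::
  "'c set \<Rightarrow> ('p, 'c) atom set \<Rightarrow> ('p, 'c) atom set \<Rightarrow> ('p, 'c) grule \<Rightarrow> (var \<Rightarrow> 'c) \<Rightarrow> bool" where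
  "supported U M J r \<sigma> \<longleftrightarrow>
     (\<forall>a\<in>pos (lits (body r)). holds_atom J (inst_atom UNIV \<sigma> a)) \<and>
     (\<forall>Ys \<phi> \<psi>. Gen Ys \<phi> \<psi> \<in> body r \<longrightarrow>
        (\<forall>\<tau>. range \<tau> \<subseteq> U \<longrightarrow> (\<forall>x. x \<notin> set Ys \<longrightarrow> \<tau> x = \<sigma> x) \<longrightarrow>
           holds_bform M (inst_bform UNIV \<tau> \<phi>) \<longrightarrow> holds_atom J (inst_atom UNIV \<tau> \<psi>)))"

lemma holds_atom_mono: "holds_atom I a \<Longrightarrow> I \<subseteq> J \<Longrightarrow> holds_atom J a"
  by (cases a) auto

lemma supported_posD:
  "supported U M J r \<sigma> \<Longrightarrow> a \<in> pos (lits (body r)) \<Longrightarrow> holds_atom J (inst_atom UNIV \<sigma> a)"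
  unfolding supported_def by blast

lemma supported_genD:
  "supported U M J r \<sigma> \<Longrightarrow> Gen Ys \<phi> \<psi> \<in> body r \<Longrightarrow> range \<tau> \<subseteq> U \<Longrightarrow> \<forall>x. x \<notin> set Ys \<longrightarrow> \<tau> x = \<sigma> x \<Longrightarrow>
    holds_bform M (inst_bform UNIV \<tau> \<phi>) \<Longrightarrow> holds_atom J (inst_atom UNIV \<tau> \<psi>)"
  unfolding supported_def by blast

lemma supported_mono: "supported U M I r \<sigma> \<Longrightarrow> I \<subseteq> J \<Longrightarrow> supported U M J r \<sigma>"
  unfolding supported_def by (blast intro: holds_atom_mono)

section \<open>Dependence on the variables of a rule\<close>

lemma vars_pos_body: "a \<in> pos (lits (body r)) \<Longrightarrow> x \<in> vars_atom a \<Longrightarrow> x \<in> vars_rule r"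
  by (force simp: vars_rule_def vars_lit_def pos_def lits_def)

lemma vars_pos_head: "a \<in> pos (head r) \<Longrightarrow> x \<in> vars_atom a \<Longrightarrow> x \<in> vars_rule r"
  by (force simp: vars_rule_def vars_lit_def pos_def)

lemma vars_rule_subset_all_vars: "r \<in> P \<Longrightarrow> vars_rule r \<subseteq> all_vars P"
proof -
  assume r: "r \<in> P"
  have "free_vars_gliteral g \<subseteq> all_vars_gliteral g" for g :: "('a, 'b) atom gliteral"
    by (cases g) auto
  with r show ?thesis by (fastforce simp: vars_rule_def all_vars_def)
qed

lemma naf_ok_cong:
  assumes "\<And>x. x \<in> vars_rule r \<Longrightarrow> \<sigma> x = \<tau> x"
  shows "naf_ok M r \<sigma> = naf_ok M r \<tau>"
proof -
  have "inst_atom UNIV \<sigma> a = inst_atom UNIV \<tau> a" if "a \<in> neg (head r) \<union> neg (lits (body r))" for a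
    by (rule inst_atom_cong) (use assms that vars_neg_head vars_neg_body in blast)
  then show ?thesis by (auto simp: naf_ok_def)
qed

text \<open>Quantified variables are ranged over anyway, and every other variable of a g-literal of
  \<open>r\<close> belongs to \<open>vars_rule r\<close>.\<close>

lemma supported_cong:
  assumes eq: "\<And>x. x \<in> vars_rule r \<Longrightarrow> \<sigma> x = \<tau> x" and \<sigma>: "range \<sigma> \<subseteq> U"
    and supp: "supported U M J r \<sigma>"
  shows "supported U M J r \<tau>"
  unfolding supported_def
proof (intro conjI ballI allI impI)
  fix a assume a: "a \<in> pos (lits (body r))"
  have "inst_atom UNIV \<sigma> a = inst_atom UNIV \<tau> a"
    by (rule inst_atom_cong) (use eq vars_pos_body[OF a] in blast)
  then show "holds_atom J (inst_atom UNIV \<tau> a)"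
    using supported_posD[OF supp a] by simp
next
  fix Ys \<phi> \<psi> \<rho>
  assume g: "Gen Ys \<phi> \<psi> \<in> body r" and \<rho>: "range \<rho> \<subseteq> U" "\<forall>x. x \<notin> set Ys \<longrightarrow> \<rho> x = \<tau> x"
    and h: "holds_bform M (inst_bform UNIV \<rho> \<phi>)"
  \<comment> \<open>\<open>\<pi>\<close> keeps the values chosen for \<open>Ys\<close> and returns
    to \<open>\<sigma>\<close> elsewhere, so that the support under \<open>\<sigma>\<close> applies
    to it.\<close>
  define \<pi> where "\<pi> = (\<lambda>x. if x \<in> set Ys then \<rho> x else \<sigma> x)"
  have eq': "\<pi> x = \<rho> x" if "x \<in> vars_bform \<phi> \<union> vars_atom \<psi>" for x
  proof (cases "x \<in> set Ys")
    case False
    then have "x \<in> free_vars_gliteral (Gen Ys \<phi> \<psi>)" using that by simp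
    then have "x \<in> vars_rule r" using g unfolding vars_rule_def by blast
    then show ?thesis using False eq \<rho>(2) by (simp add: \<pi>_def)
  qed (simp add: \<pi>_def)
  have \<phi>: "inst_bform UNIV \<pi> \<phi> = inst_bform UNIV \<rho> \<phi>"
    by (rule inst_bform_cong) (use eq' in blast)
  have \<psi>: "inst_atom UNIV \<pi> \<psi> = inst_atom UNIV \<rho> \<psi>"
    by (rule inst_atom_cong) (use eq' in blast)
  have "range \<pi> \<subseteq> U" "\<forall>x. x \<notin> set Ys \<longrightarrow> \<pi> x = \<sigma> x"
    using \<sigma> \<rho>(1) by (auto simp: \<pi>_def)
  then have "holds_atom J (inst_atom UNIV \<pi> \<psi>)"
    using supported_genD[OF supp g] h \<phi> by simp
  then show "holds_atom J (inst_atom UNIV \<rho> \<psi>)" by (simp add: \<psi>)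
qed

section \<open>Models of the composed reducts\<close>

lemma is_model_gl_reduct:
  "is_model J (gl_reduct M Q) \<longleftrightarrow>
    (\<forall>r\<in>Q. (\<forall>a\<in>neg (body r). \<not> holds_atom M a) \<longrightarrow> (\<forall>a\<in>neg (head r). holds_atom M a) \<longrightarrow>
       (\<forall>a\<in>pos (body r). holds_atom J a) \<longrightarrow> (\<exists>a\<in>pos (head r). holds_atom J a))"
proof -
  have "satisfies J (Rule (Pos ` A) (Pos ` B)) \<longleftrightarrow>
      (\<forall>a\<in>B. holds_atom J a) \<longrightarrow> (\<exists>a\<in>A. holds_atom J a)" for A B
    by (simp add: satisfies_def)
  moreover have "(\<forall>q\<in>{F r | r. r \<in> Q \<and> C r \<and> D r}. X q) \<longleftrightarrow> (\<forall>r\<in>Q. C r \<longrightarrow> D r \<longrightarrow> X (F r))"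
    for F C D and X :: "('a, 'b) lrule \<Rightarrow> bool"
    by blast
  ultimately show ?thesis
    unfolding is_model_def gl_reduct_def by simp
qed

text \<open>The Gelfond-Lifschitz reduct tests naf-literals in \<open>M\<close>, and the GeLi-reduct
  freezes antecedents there; only positive atoms and consequents are left to \<open>J\<close>. From
  here on, valuations of the original rules replace ground rules.\<close>

lemma is_model_reduct:
  "is_model J (gl_reduct M (geli_reduct U M (ground U P))) \<longleftrightarrow>
    (\<forall>r\<in>P. \<forall>\<sigma>. range \<sigma> \<subseteq> U \<longrightarrow> naf_ok M r \<sigma> \<longrightarrow> supported U M J r \<sigma> \<longrightarrow>
       (\<exists>a\<in>pos (head r). holds_atom J (inst_atom UNIV \<sigma> a)))"
proof -
  \<comment> \<open>\<open>gs r \<sigma>\<close> collects the literals which the GeLi-reduct adds to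
    the body of the ground rule.\<close>
  define gs where "gs r \<sigma> = {Pos (inst_atom (set Ys) \<tau> \<psi>) | Ys \<phi> \<psi> \<tau>. Gen Ys \<phi> \<psi> \<in> ground_gliteral \<sigma> ` body r
      \<and> range \<tau> \<subseteq> U \<and> holds_bform M (inst_bform (set Ys) \<tau> \<phi>)}"
    for r :: "('a, 'b) grule" and \<sigma>
  have neg_gs: "neg (gs r \<sigma>) = {}" for r \<sigma>
    by (auto simp: gs_def neg_def)
  have pos_gs: "pos (gs r \<sigma>) = {inst_atom UNIV \<tau> \<psi> | Ys \<phi> \<psi> \<tau>. Gen Ys \<phi> \<psi> \<in> body r \<and> range \<tau> \<subseteq> U
      \<and> (\<forall>x. x \<notin> set Ys \<longrightarrow> \<tau> x = \<sigma> x) \<and> holds_bform M (inst_bform UNIV \<tau> \<phi>)}" (is "_ = ?G")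
    if \<sigma>: "range \<sigma> \<subseteq> U" for r \<sigma>
  proof (intro equalityI subsetI)
    fix a assume "a \<in> pos (gs r \<sigma>)"
    then obtain Ys \<phi> \<psi> \<tau> where *: "a = inst_atom (set Ys) \<tau> (inst_atom (- set Ys) \<sigma> \<psi>)" "Gen Ys \<phi> \<psi> \<in> body r"
      "range \<tau> \<subseteq> U" "holds_bform M (inst_bform (set Ys) \<tau> (inst_bform (- set Ys) \<sigma> \<phi>))"
      by (auto simp: pos_def gs_def Gen_mem_ground_gliteral)
    \<comment> \<open>The reduct chooses the values of \<open>Ys\<close>, the grounding of the rule
      those of all other variables; \<open>\<rho>\<close> merges both.\<close>
    define \<rho> where "\<rho> = (\<lambda>x. if x \<in> set Ys then \<tau> x else \<sigma> x)"
    have "range \<rho> \<subseteq> U" "\<forall>x. x \<notin> set Ys \<longrightarrow> \<rho> x = \<sigma> x"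
      using \<sigma> *(3) by (auto simp: \<rho>_def)
    with * show "a \<in> ?G"
      unfolding inst_atom_inst_atom inst_bform_inst_bform \<rho>_def[symmetric] by blast
  next
    fix a assume "a \<in> ?G"
    then obtain Ys \<phi> \<psi> \<tau> where *: "a = inst_atom UNIV \<tau> \<psi>" "Gen Ys \<phi> \<psi> \<in> body r" "range \<tau> \<subseteq> U"
      "\<forall>x. x \<notin> set Ys \<longrightarrow> \<tau> x = \<sigma> x" "holds_bform M (inst_bform UNIV \<tau> \<phi>)"
      by auto
    \<comment> \<open>Agreement with \<open>\<sigma>\<close> outside \<open>Ys\<close> lets
      \<open>\<tau>\<close> be split back into the two stages.\<close>
    have "\<tau> = (\<lambda>x. if x \<in> set Ys then \<tau> x else \<sigma> x)"
      using *(4) by auto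
    then have "a = inst_atom (set Ys) \<tau> (inst_atom (- set Ys) \<sigma> \<psi>)"
      "holds_bform M (inst_bform (set Ys) \<tau> (inst_bform (- set Ys) \<sigma> \<phi>))"
      using *(1,5) unfolding inst_atom_inst_atom inst_bform_inst_bform by metis+
    moreover have "Gen Ys (inst_bform (- set Ys) \<sigma> \<phi>) (inst_atom (- set Ys) \<sigma> \<psi>) \<in> ground_gliteral \<sigma> ` body r"
      using *(2) by (auto simp: Gen_mem_ground_gliteral)
    ultimately show "a \<in> pos (gs r \<sigma>)"
      using *(3) unfolding pos_def gs_def by blast
  qed
  \<comment> \<open>\<open>F\<close> is the GeLi-reduct of a single rule; it presents the whole
    reduct as an image, over which bounded quantifiers can be evaluated.\<close>
  define F where "F q = Rule (head q) (lits (body q) \<union> {Pos (inst_atom (set Ys) \<tau> \<psi>) | Ys \<phi> \<psi> \<tau>.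
      Gen Ys \<phi> \<psi> \<in> body q \<and> range \<tau> \<subseteq> U \<and> holds_bform M (inst_bform (set Ys) \<tau> \<phi>)})"
    for q :: "('a, 'b) grule"
  have geli: "geli_reduct U M (ground U P) = {F q | q. q \<in> ground U P}"
    by (simp only: geli_reduct_def F_def)
  have F: "F (ground_rule \<sigma> r) =
      Rule (inst_lit UNIV \<sigma> ` head r) (inst_lit UNIV \<sigma> ` lits (body r) \<union> gs r \<sigma>)" for r \<sigma>
    by (simp only: F_def ground_rule_def gs_def rule.sel lits_ground_gliteral)
  have supp: "supported U M J r \<sigma> \<longleftrightarrow>
      (\<forall>a\<in>pos (lits (body r)). holds_atom J (inst_atom UNIV \<sigma> a)) \<and> (\<forall>a\<in>pos (gs r \<sigma>). holds_atom J a)"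
    if "range \<sigma> \<subseteq> U" for r \<sigma>
    unfolding pos_gs[OF that] supported_def by blast
  have ball_F: "(\<forall>q\<in>{F q | q. q \<in> {ground_rule \<sigma> r | \<sigma> r. r \<in> P \<and> range \<sigma> \<subseteq> U}}. X q) \<longleftrightarrow>
      (\<forall>r\<in>P. \<forall>\<sigma>. range \<sigma> \<subseteq> U \<longrightarrow> X (F (ground_rule \<sigma> r)))" for X
    by blast
  have "is_model J (gl_reduct M (geli_reduct U M (ground U P))) \<longleftrightarrow>
      (\<forall>r\<in>P. \<forall>\<sigma>. range \<sigma> \<subseteq> U \<longrightarrow>
        (\<forall>a\<in>neg (body (F (ground_rule \<sigma> r))). \<not> holds_atom M a) \<longrightarrow>
        (\<forall>a\<in>neg (head (F (ground_rule \<sigma> r))). holds_atom M a) \<longrightarrow>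
        (\<forall>a\<in>pos (body (F (ground_rule \<sigma> r))). holds_atom J a) \<longrightarrow>
        (\<exists>a\<in>pos (head (F (ground_rule \<sigma> r))). holds_atom J a))"
    unfolding is_model_gl_reduct geli unfolding ground_def ball_F ..
  also have "\<dots> \<longleftrightarrow> (\<forall>r\<in>P. \<forall>\<sigma>. range \<sigma> \<subseteq> U \<longrightarrow> naf_ok M r \<sigma> \<longrightarrow> supported U M J r \<sigma> \<longrightarrow>
       (\<exists>a\<in>pos (head r). holds_atom J (inst_atom UNIV \<sigma> a)))"
  proof (intro ball_cong all_cong refl)
    fix r :: "('a, 'b) grule" and \<sigma> :: "var \<Rightarrow> 'b" assume "range \<sigma> \<subseteq> U"
    show "((\<forall>a\<in>neg (body (F (ground_rule \<sigma> r))). \<not> holds_atom M a) \<longrightarrow>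
        (\<forall>a\<in>neg (head (F (ground_rule \<sigma> r))). holds_atom M a) \<longrightarrow>
        (\<forall>a\<in>pos (body (F (ground_rule \<sigma> r))). holds_atom J a) \<longrightarrow>
        (\<exists>a\<in>pos (head (F (ground_rule \<sigma> r))). holds_atom J a)) \<longleftrightarrow>
      (naf_ok M r \<sigma> \<longrightarrow> supported U M J r \<sigma> \<longrightarrow> (\<exists>a\<in>pos (head r). holds_atom J (inst_atom UNIV \<sigma> a)))"
      unfolding F rule.sel pos_inst_lit neg_inst_lit pos_Un neg_Un neg_gs naf_ok_def
        supp[OF \<open>range \<sigma> \<subseteq> U\<close>] ball_Un ball_simps bex_simps by argo
  qed
  finally show ?thesis .
qed

section \<open>Truth of the completion\<close>

text \<open>A quantifier block is described by total valuations agreeing outside the block, the form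
  used in \<open>supported\<close>. If a variable is repeated in \<open>Xs\<close>, the inner choice
  overrides the outer one.\<close>

lemma sat_alls:
  assumes "range \<nu> \<subseteq> U"
  shows "sat U N V \<nu> (alls Xs f) \<longleftrightarrow>
    (\<forall>\<tau>. range \<tau> \<subseteq> U \<longrightarrow> (\<forall>x. x \<notin> set Xs \<longrightarrow> \<tau> x = \<nu> x) \<longrightarrow> sat U N V \<tau> f)"
  using assms
proof (induction Xs arbitrary: \<nu>)
  case Nil
  have "(\<forall>x. \<tau> x = \<nu> x) \<longleftrightarrow> \<tau> = \<nu>" for \<tau> by auto
  with Nil show ?case by (auto simp: alls_def)
next
  case (Cons X Xs)
  have upd: "range (\<nu>(X := c)) \<subseteq> U" if "c \<in> U" for c
    using Cons.prems that by auto
  have "sat U N V \<nu> (alls (X # Xs) f) \<longleftrightarrow> (\<forall>c\<in>U. sat U N V (\<nu>(X := c)) (alls Xs f))"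
    by (simp add: alls_def)
  also have "\<dots> \<longleftrightarrow> (\<forall>c\<in>U. \<forall>\<tau>. range \<tau> \<subseteq> U \<longrightarrow> (\<forall>x. x \<notin> set Xs \<longrightarrow> \<tau> x = (\<nu>(X := c)) x) \<longrightarrow> sat U N V \<tau> f)"
    by (intro ball_cong refl Cons.IH[OF upd])
  also have "\<dots> \<longleftrightarrow> (\<forall>\<tau>. range \<tau> \<subseteq> U \<longrightarrow> (\<forall>x. x \<notin> set (X # Xs) \<longrightarrow> \<tau> x = \<nu> x) \<longrightarrow> sat U N V \<tau> f)"
    (is "?A \<longleftrightarrow> ?B")
  proof
    assume A: ?A
    show ?B
    proof (intro allI impI)
      fix \<tau> assume \<tau>: "range \<tau> \<subseteq> U" "\<forall>x. x \<notin> set (X # Xs) \<longrightarrow> \<tau> x = \<nu> x"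
      \<comment> \<open>The outermost quantifier is instantiated with the value that
        \<open>\<tau>\<close> itself gives to \<open>X\<close>.\<close>
      then have "\<tau> X \<in> U" "\<forall>x. x \<notin> set Xs \<longrightarrow> \<tau> x = (\<nu>(X := \<tau> X)) x" by auto
      with A \<tau>(1) show "sat U N V \<tau> f" by blast
    qed
  next
    assume B: ?B
    show ?A
    proof (intro ballI allI impI)
      fix c \<tau> assume "c \<in> U" and \<tau>: "range \<tau> \<subseteq> U" "\<forall>x. x \<notin> set Xs \<longrightarrow> \<tau> x = (\<nu>(X := c)) x"
      then have "\<forall>x. x \<notin> set (X # Xs) \<longrightarrow> \<tau> x = \<nu> x" by auto
      with B \<tau>(1) show "sat U N V \<tau> f" by blast
    qed
  qed
  finally show ?case .
qed

lemma sat_exs: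
  assumes "range \<nu> \<subseteq> U"
  shows "sat U N V \<nu> (exs Xs f) \<longleftrightarrow>
    (\<exists>\<tau>. range \<tau> \<subseteq> U \<and> (\<forall>x. x \<notin> set Xs \<longrightarrow> \<tau> x = \<nu> x) \<and> sat U N V \<tau> f)"
proof -
  have "sat U N V \<nu> (exs Xs f) \<longleftrightarrow> \<not> sat U N V \<nu> (alls Xs (FNeg f))"
    by (induction Xs arbitrary: \<nu>) (simp_all add: exs_def alls_def)
  then show ?thesis unfolding sat_alls[OF assms] sat.simps(5) by blast
qed

text \<open>Truth in \<open>models\<close> already means truth under every valuation in
  \<open>U\<close>. Hence the sentences of the completion can be checked without their universal
  prefixes.\<close>

lemma models_alls: "models U N (alls Xs f) \<longleftrightarrow> models U N f"
proof -
  have "models U N (alls Xs f) \<longleftrightarrow> (\<forall>V \<nu>. range \<nu> \<subseteq> U \<longrightarrow>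
      (\<forall>\<tau>. range \<tau> \<subseteq> U \<longrightarrow> (\<forall>x. x \<notin> set Xs \<longrightarrow> \<tau> x = \<nu> x) \<longrightarrow> sat U N V \<tau> f))"
    unfolding models_def by (intro arg_cong[where f = All] ext imp_cong refl) (rule sat_alls)
  then show ?thesis unfolding models_def by blast
qed

lemma models_big_conj: "finite F \<Longrightarrow> models U N (big_conj F) \<longleftrightarrow> (\<forall>f\<in>F. models U N f)"
  by (auto simp: models_def sat_conj)

section \<open>Interpretation of the program predicates and of the names\<close>

abbreviation completion_atoms ::
  "('p, 'c) grule set \<Rightarrow> 'c set \<Rightarrow> ('p, 'c) atom set \<Rightarrow> (('p, 'c) sym, 'c) atom set" where
  "completion_atoms P U M \<equiv> lift_atom ` M \<union> R_set P U M \<union> G_set P U M"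

lemma lift_atom_simps:
  "lift_atom (Rel q ts) = Rel (Orig q) ts" "lift_atom (Equ s t) = Equ s t"
  by (simp_all add: lift_atom_def trm.map_id list.map_id0 trm.map_id0)

text \<open>\<open>R\<close> and \<open>G\<close> contain only atoms over names, and the
  constructors of \<open>sym\<close> are distinct; so formulas over the original predicates keep the
  truth values they have in \<open>M\<close>.\<close>

lemma Rel_Orig_mem: "Rel (Orig q) ts \<in> completion_atoms P U M \<longleftrightarrow> Rel q ts \<in> M"
proof -
  have "Rel (Orig q) ts = lift_atom a \<longleftrightarrow> a = Rel q ts" for a
    by (cases a) (auto simp: lift_atom_simps)
  then show ?thesis
    by (auto simp: R_set_def G_set_def rule_atom_def gen_atom_def image_iff)
qed

lemma sat_fo_atom:
  "sat U (completion_atoms P U M) V \<nu> (fo_atom a) \<longleftrightarrow> holds_atom M (inst_atom UNIV \<nu> a)"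
  by (cases a) (simp_all add: fo_atom_def lift_atom_simps Rel_Orig_mem del: Un_iff)

lemma sat_fo_lit:
  "sat U (completion_atoms P U M) V \<nu> (fo_lit l) \<longleftrightarrow> holds_lit M (inst_lit UNIV \<nu> l)"
  by (cases l) (simp_all add: sat_fo_atom)

lemma sat_fo_bform:
  "sat U (completion_atoms P U M) V \<nu> (fo_bform \<phi>) \<longleftrightarrow> holds_bform M (inst_bform UNIV \<nu> \<phi>)"
  by (induction \<phi>) (simp_all add: sat_fo_atom)

text \<open>The witness \<open>\<sigma>\<close> in \<open>R\<close> may differ from
  \<open>\<nu>\<close>, but the arguments of the name list all of \<open>vars_rule r\<close>, and
  \<open>naf_ok\<close> depends on nothing else. As a rule is its own name, no other rule
  contributes this atom.\<close>

lemma inst_rule_atom_mem: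
  assumes "r \<in> P" and "finite (vars_rule r)" and \<nu>: "range \<nu> \<subseteq> U"
  shows "inst_atom UNIV \<nu> (rule_atom r) \<in> completion_atoms P U M \<longleftrightarrow> naf_ok M r \<nu>"
proof -
  have naf: "(\<forall>a \<in> neg (head (ground_rule \<sigma> r)). holds_atom M a) \<and>
      (\<forall>a \<in> neg (lits (body (ground_rule \<sigma> r))). holds_lit M (Naf a)) \<longleftrightarrow> naf_ok M r \<sigma>" for r \<sigma>
    by (simp add: ground_rule_def neg_inst_lit lits_ground_gliteral naf_ok_def)
  have "inst_atom UNIV \<nu> (rule_atom r) \<noteq> lift_atom a" for a
    by (cases a) (simp_all add: rule_atom_def lift_atom_simps)
  then have "inst_atom UNIV \<nu> (rule_atom r) \<in> completion_atoms P U M \<longleftrightarrow>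
      inst_atom UNIV \<nu> (rule_atom r) \<in> R_set P U M"
    by (auto simp: G_set_def rule_atom_def gen_atom_def)
  also have "\<dots> \<longleftrightarrow> (\<exists>\<sigma>. range \<sigma> \<subseteq> U \<and> (\<forall>x\<in>vars_rule r. \<nu> x = \<sigma> x) \<and> naf_ok M r \<sigma>)"
    unfolding R_set_def naf using assms(1,2) by (auto simp: rule_atom_def)
  also have "\<dots> \<longleftrightarrow> naf_ok M r \<nu>"
    using \<nu> naf_ok_cong by metis
  finally show ?thesis .
qed

text \<open>As for rules: the arguments are all variables of \<open>\<phi>\<close>, quantified or
  not, so they determine its truth value.\<close>

lemma inst_gen_atom_mem:
  assumes "r \<in> P" and "Gen Ys \<phi> \<psi> \<in> body r" and \<nu>: "range \<nu> \<subseteq> U"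
  shows "inst_atom UNIV \<nu> (gen_atom Ys \<phi> \<psi>) \<in> completion_atoms P U M \<longleftrightarrow>
    holds_bform M (inst_bform UNIV \<nu> \<phi>)"
proof -
  have "inst_atom UNIV \<nu> (gen_atom Ys \<phi> \<psi>) \<noteq> lift_atom a" for a
    by (cases a) (simp_all add: gen_atom_def lift_atom_simps)
  then have "inst_atom UNIV \<nu> (gen_atom Ys \<phi> \<psi>) \<in> completion_atoms P U M \<longleftrightarrow>
      inst_atom UNIV \<nu> (gen_atom Ys \<phi> \<psi>) \<in> G_set P U M"
    by (auto simp: R_set_def rule_atom_def gen_atom_def)
  also have "\<dots> \<longleftrightarrow> (\<exists>\<sigma>. range \<sigma> \<subseteq> U \<and> (\<forall>x\<in>vars_bform \<phi>. \<nu> x = \<sigma> x) \<and>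
      holds_bform M (inst_bform UNIV \<sigma> \<phi>))"
    unfolding G_set_def using assms(1,2) by (auto simp: gen_atom_def finite_vars_bform)
  also have "\<dots> \<longleftrightarrow> holds_bform M (inst_bform UNIV \<nu> \<phi>)"
    using \<nu> inst_bform_cong by metis
  finally show ?thesis .
qed

lemma sat_rule_atom:
  assumes "r \<in> P" and "finite (vars_rule r)" and "range \<nu> \<subseteq> U"
  shows "sat U (completion_atoms P U M) V \<nu> (FAtom (rule_atom r)) \<longleftrightarrow> naf_ok M r \<nu>"
proof -
  have "holds_atom N (inst_atom UNIV \<nu> (rule_atom r)) \<longleftrightarrow> inst_atom UNIV \<nu> (rule_atom r) \<in> N" for N
    by (simp add: rule_atom_def)
  then show ?thesis using inst_rule_atom_mem[OF assms] by simp
qed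

lemma sat_gen_atom:
  assumes "r \<in> P" and "Gen Ys \<phi> \<psi> \<in> body r" and "range \<nu> \<subseteq> U"
  shows "sat U (completion_atoms P U M) V \<nu> (FAtom (gen_atom Ys \<phi> \<psi>)) \<longleftrightarrow>
    holds_bform M (inst_bform UNIV \<nu> \<phi>)"
proof -
  have "holds_atom N (inst_atom UNIV \<nu> (gen_atom Ys \<phi> \<psi>)) \<longleftrightarrow>
      inst_atom UNIV \<nu> (gen_atom Ys \<phi> \<psi>) \<in> N" for N
    by (simp add: gen_atom_def)
  then show ?thesis using inst_gen_atom_mem[OF assms] by simp
qed

section \<open>Truth of the rule sentences\<close>

lemma ball_gliteral:
  "(\<forall>g\<in>B. Q g) \<longleftrightarrow> (\<forall>a\<in>pos (lits B). Q (Lit (Pos a))) \<and> (\<forall>a\<in>neg (lits B). Q (Lit (Naf a))) \<and>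
    (\<forall>Ys \<phi> \<psi>. Gen Ys \<phi> \<psi> \<in> B \<longrightarrow> Q (Gen Ys \<phi> \<psi>))"
  unfolding pos_def neg_def lits_def by (auto, metis gliteral.exhaust lit.exhaust)

text \<open>Negated head atoms act as further premises and form \<open>naf_ok\<close> together with
  the naf-literals of the body. The rest of the body is \<open>supported\<close> with
  \<open>J = M\<close>, since antecedents and consequents are here evaluated in the same
  set.\<close>

lemma sat_rule:
  assumes fin: "finite (head r)" "finite (body r)" and \<nu>: "range \<nu> \<subseteq> U"
  shows "sat U (completion_atoms P U M) V \<nu>
      (FImp (big_conj (fo_gliteral ` body r)) (big_disj (fo_lit ` head r))) \<longleftrightarrow>
    (naf_ok M r \<nu> \<longrightarrow> supported U M M r \<nu> \<longrightarrow> (\<exists>a\<in>pos (head r). holds_atom M (inst_atom UNIV \<nu> a)))"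
proof -
  have gen: "sat U (completion_atoms P U M) V \<nu> (fo_gliteral (Gen Ys \<phi> \<psi>)) \<longleftrightarrow>
      (\<forall>\<tau>. range \<tau> \<subseteq> U \<longrightarrow> (\<forall>x. x \<notin> set Ys \<longrightarrow> \<tau> x = \<nu> x) \<longrightarrow>
         holds_bform M (inst_bform UNIV \<tau> \<phi>) \<longrightarrow> holds_atom M (inst_atom UNIV \<tau> \<psi>))" for Ys \<phi> \<psi>
    unfolding fo_gliteral.simps sat_alls[OF \<nu>] sat.simps(8) sat_fo_bform sat_fo_atom ..
  have "(\<forall>g\<in>body r. sat U (completion_atoms P U M) V \<nu> (fo_gliteral g)) \<longleftrightarrow>
      (\<forall>a\<in>neg (lits (body r)). \<not> holds_atom M (inst_atom UNIV \<nu> a)) \<and> supported U M M r \<nu>"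
    unfolding ball_gliteral[of "body r"] gen supported_def
    unfolding fo_gliteral.simps(1) fo_lit.simps sat.simps(5) sat_fo_atom by argo
  moreover have "(\<exists>l\<in>head r. holds_lit M (inst_lit UNIV \<nu> l)) \<longleftrightarrow>
      (\<exists>a\<in>pos (head r). holds_atom M (inst_atom UNIV \<nu> a)) \<or>
      \<not> (\<forall>a\<in>neg (head r). holds_atom M (inst_atom UNIV \<nu> a))" (is "?L \<longleftrightarrow> ?R")
  proof
    assume ?L
    then obtain l where "l \<in> head r" "holds_lit M (inst_lit UNIV \<nu> l)" by blast
    then show ?R by (cases l) (auto simp: pos_def neg_def)
  qed (force simp: pos_def neg_def)
  ultimately show ?thesis
    unfolding sat.simps(8) naf_ok_def
    by (simp add: sat_conj sat_disj fin sat_fo_lit del: Un_iff) blast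
qed

section \<open>The fixed point formula\<close>

text \<open>The fixed point is a set of tuples while models are sets of atoms; this is the passage
  between them.\<close>

definition rel_set :: "'p \<Rightarrow> 'c list set \<Rightarrow> ('p, 'c) atom set" where
  "rel_set p S = (\<lambda>xs. Rel p (map Const xs)) ` S"

lemma Rel_mem_rel_set: "Rel p (map Const xs) \<in> rel_set p S \<longleftrightarrow> xs \<in> S"
proof -
  have "inj (\<lambda>xs. Rel p (map Const xs))" by (auto intro!: injI elim!: list.inj_map_strong[rotated])
  then show ?thesis unfolding rel_set_def by (rule inj_image_mem_iff)
qed

text \<open>This is the immediate consequence operator of the reduct, with \<open>M\<close> as a
  fixed parameter. The disjunct \<open>xs \<in> S\<close> mirrors
  \<open>FPVar W (map Var Xs)\<close> in \<open>phi_formula\<close>.\<close>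

definition conseq ::
  "'p \<Rightarrow> nat \<Rightarrow> ('p, 'c) grule set \<Rightarrow> 'c set \<Rightarrow> ('p, 'c) atom set \<Rightarrow> 'c list set \<Rightarrow> 'c list set" where
  "conseq p n P U M S =
     {xs. length xs = n \<and> set xs \<subseteq> U \<and> (xs \<in> S \<or>
        (\<exists>r\<in>P. \<exists>ts \<sigma>. Rel p ts \<in> pos (head r) \<and> range \<sigma> \<subseteq> U \<and> map (val \<sigma>) ts = xs \<and>
           naf_ok M r \<sigma> \<and> supported U M (rel_set p S) r \<sigma>))}"

text \<open>With naf-literals and antecedents frozen in \<open>M\<close>, the argument occurs only
  positively.\<close>

lemma mono_conseq: "mono (conseq p n P U M)"
proof (rule monoI)
  fix S T :: "'a list set" assume ST: "S \<subseteq> T"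
  then have "rel_set p S \<subseteq> rel_set p T" by (auto simp: rel_set_def)
  then show "conseq p n P U M S \<subseteq> conseq p n P U M T"
    unfolding conseq_def using ST supported_mono[of U M "rel_set p S" _ _ "rel_set p T"] by blast
qed

text \<open>When \<open>p\<close> is the only possible predicate of \<open>a\<close>, every regular
  atom is read through \<open>W\<close>, and equality is identity; so \<open>N\<close> does not
  enter.\<close>

lemma sat_repl_atom:
  assumes "\<And>q ts. a = Rel q ts \<Longrightarrow> q = p"
  shows "sat U N V \<nu> (repl_atom p W a) \<longleftrightarrow> holds_atom (rel_set p (V W)) (inst_atom UNIV \<nu> a)"
proof (cases a)
  case (Rel q ts)
  with assms have "q = p" by blast
  then show ?thesis
    unfolding Rel inst_atom_UNIV_Rel
    by (simp only: repl_atom.simps if_True refl sat.simps holds_atom.simps Rel_mem_rel_set)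
qed (simp add: fo_atom_def lift_atom_simps)

section \<open>Finiteness and the restriction to one predicate\<close>

lemma p_program_finite:
  assumes "p_program p n P" and "r \<in> P"
  shows "finite (head r)" and "finite (body r)"
  using assms by (auto simp: p_program_def generalized_program_def is_rule_def)

lemma p_program_Rel:
  assumes "p_program p n P" and "r \<in> P" and "Rel q ts \<in> atoms_rule r"
  shows "q = p" and "length ts = n"
proof -
  have "(q, length ts) \<in> preds P" using assms by (auto simp: preds_def)
  then show "q = p" "length ts = n" using assms by (auto simp: p_program_def)
qed

lemma atoms_ruleI:
  "a \<in> pos (head r) \<Longrightarrow> a \<in> atoms_rule r"
  "a \<in> pos (lits (body r)) \<Longrightarrow> a \<in> atoms_rule r"
  "Gen Ys \<phi> a \<in> body r \<Longrightarrow> a \<in> atoms_rule r"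
  by (force simp: atoms_rule_def pos_def lits_def)+

text \<open>The antecedent is tested through \<open>gen_atom\<close>, which \<open>G\<close> ties to
  the truth of \<open>\<phi>\<close> in \<open>M\<close>; only the consequent moves with
  \<open>W\<close>. In this way the formula imitates the GeLi-reduct and stays positive in
  \<open>W\<close>.\<close>

lemma sat_repl_gen:
  assumes P: "p_program p n P" "r \<in> P" and g: "Gen Ys \<phi> \<psi> \<in> body r" and \<nu>: "range \<nu> \<subseteq> U"
  shows "sat U (completion_atoms P U M) V \<nu> (repl_gen p W Ys \<phi> \<psi>) \<longleftrightarrow>
    (\<forall>\<tau>. range \<tau> \<subseteq> U \<longrightarrow> (\<forall>x. x \<notin> set Ys \<longrightarrow> \<tau> x = \<nu> x) \<longrightarrow>
       holds_bform M (inst_bform UNIV \<tau> \<phi>) \<longrightarrow> holds_atom (rel_set p (V W)) (inst_atom UNIV \<tau> \<psi>))"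
proof -
  have "sat U N V \<tau> (repl_atom p W \<psi>) \<longleftrightarrow> holds_atom (rel_set p (V W)) (inst_atom UNIV \<tau> \<psi>)" for N \<tau>
    by (rule sat_repl_atom) (use p_program_Rel(1)[OF P] atoms_ruleI(3)[OF g] in blast)
  then show ?thesis
    unfolding repl_gen_def sat_alls[OF \<nu>] sat.simps(8)
    using sat_gen_atom[OF P(2) g] by (metis (no_types, lifting))
qed

text \<open>The quantifiers change values on \<open>vars_rule r\<close> only, but
  \<open>naf_ok\<close> and \<open>supported\<close> look nowhere else, so any
  \<open>\<sigma>\<close> in \<open>U\<close> may serve. The variables \<open>Xs\<close> are foreign
  to the rule and keep their values under \<open>\<nu>\<close>.\<close>

lemma sat_E_formula:
  assumes P: "p_program p n P" "r \<in> P" and ts: "Rel p ts \<in> pos (head r)"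
    and Xs: "length Xs = n" "set Xs \<inter> all_vars P = {}" and \<nu>: "range \<nu> \<subseteq> U"
  shows "sat U (completion_atoms P U M) V \<nu> (E_formula p W Xs ts r) \<longleftrightarrow>
    (\<exists>\<sigma>. range \<sigma> \<subseteq> U \<and> map (val \<sigma>) ts = map \<nu> Xs \<and> naf_ok M r \<sigma> \<and>
       supported U M (rel_set p (V W)) r \<sigma>)"
proof -
  let ?N = "completion_atoms P U M"
  note fin = p_program_finite[OF P]
  note fv = finite_vars_rule[OF fin]
  \<comment> \<open>Equal lengths keep \<open>map2\<close> from dropping an equation.\<close>
  have len: "length ts = length Xs"
    using p_program_Rel(2)[OF P atoms_ruleI(1)[OF ts]] Xs(1) by simp
  have supp: "sat U ?N V \<tau> (big_conj (repl_atom p W ` pos (lits (body r)))) \<and>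
      sat U ?N V \<tau> (big_conj {repl_gen p W Ys \<phi> \<psi> | Ys \<phi> \<psi>. Gen Ys \<phi> \<psi> \<in> body r}) \<longleftrightarrow>
      supported U M (rel_set p (V W)) r \<tau>" if \<tau>: "range \<tau> \<subseteq> U" for \<tau>
  proof -
    have 1: "sat U ?N V \<tau> (repl_atom p W a) \<longleftrightarrow> holds_atom (rel_set p (V W)) (inst_atom UNIV \<tau> a)"
      if "a \<in> pos (lits (body r))" for a
      by (rule sat_repl_atom) (use p_program_Rel(1)[OF P] atoms_ruleI(2)[OF that] in blast)
    have "(\<forall>f\<in>{repl_gen p W Ys \<phi> \<psi> | Ys \<phi> \<psi>. Gen Ys \<phi> \<psi> \<in> body r}. sat U ?N V \<tau> f) \<longleftrightarrow>
        (\<forall>Ys \<phi> \<psi>. Gen Ys \<phi> \<psi> \<in> body r \<longrightarrow> sat U ?N V \<tau> (repl_gen p W Ys \<phi> \<psi>))"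
      by blast
    also have "\<dots> \<longleftrightarrow> (\<forall>Ys \<phi> \<psi>. Gen Ys \<phi> \<psi> \<in> body r \<longrightarrow>
        (\<forall>\<rho>. range \<rho> \<subseteq> U \<longrightarrow> (\<forall>x. x \<notin> set Ys \<longrightarrow> \<rho> x = \<tau> x) \<longrightarrow>
          holds_bform M (inst_bform UNIV \<rho> \<phi>) \<longrightarrow> holds_atom (rel_set p (V W)) (inst_atom UNIV \<rho> \<psi>)))"
      using sat_repl_gen[OF P _ \<tau>, of _ _ _ M V W] by (auto simp del: Un_iff)
    finally show ?thesis
      using 1 unfolding supported_def
      by (simp add: sat_conj finite_imageI finite_pos finite_lits fin finite_gen_image[OF fin(2)])
  qed
  have eqs: "sat U ?N V \<tau> (conj_list (map2 (\<lambda>X t. FAtom (Equ (Var X) t)) Xs ts)) \<longleftrightarrow>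
      map (val \<tau>) ts = map \<tau> Xs" for \<tau>
    using len by (auto simp: sat_conj_list inst_trm_UNIV set_zip list_eq_iff_nth_eq, metis)
  have matrix: "sat U ?N V \<tau> (conj_list
      [conj_list (map2 (\<lambda>X t. FAtom (Equ (Var X) t)) Xs ts),
       big_conj (repl_atom p W ` pos (lits (body r))),
       big_conj {repl_gen p W Ys \<phi> \<psi> | Ys \<phi> \<psi>. Gen Ys \<phi> \<psi> \<in> body r},
       FAtom (rule_atom r)]) \<longleftrightarrow>
      map (val \<tau>) ts = map \<tau> Xs \<and> supported U M (rel_set p (V W)) r \<tau> \<and> naf_ok M r \<tau>"
    if \<tau>: "range \<tau> \<subseteq> U" for \<tau>
    unfolding sat_conj_list[of _ _ _ _ "[_, _, _, _]"] list.set ball_simps eqs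
      sat_rule_atom[OF P(2) fv \<tau>] supp[OF \<tau>, symmetric]
    by blast
  have E: "sat U ?N V \<nu> (E_formula p W Xs ts r) \<longleftrightarrow>
      (\<exists>\<tau>. range \<tau> \<subseteq> U \<and> (\<forall>x. x \<notin> vars_rule r \<longrightarrow> \<tau> x = \<nu> x) \<and> map (val \<tau>) ts = map \<tau> Xs \<and>
         supported U M (rel_set p (V W)) r \<tau> \<and> naf_ok M r \<tau>)"
    unfolding E_formula_def sat_exs[OF \<nu>] set_sorted_list_of_set[OF fv] using matrix by blast
  have disj: "x \<notin> vars_rule r" if "x \<in> set Xs" for x
    using that Xs(2) vars_rule_subset_all_vars[OF P(2)] by blast
  show ?thesis
  proof
    assume "sat U ?N V \<nu> (E_formula p W Xs ts r)"
    then obtain \<tau> where \<tau>: "range \<tau> \<subseteq> U" "\<forall>x. x \<notin> vars_rule r \<longrightarrow> \<tau> x = \<nu> x"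
      "map (val \<tau>) ts = map \<tau> Xs" "supported U M (rel_set p (V W)) r \<tau>" "naf_ok M r \<tau>"
      using E by blast
    moreover have "map \<tau> Xs = map \<nu> Xs" using \<tau>(2) disj by simp
    ultimately show "\<exists>\<sigma>. range \<sigma> \<subseteq> U \<and> map (val \<sigma>) ts = map \<nu> Xs \<and> naf_ok M r \<sigma> \<and>
       supported U M (rel_set p (V W)) r \<sigma>" by auto
  next
    assume "\<exists>\<sigma>. range \<sigma> \<subseteq> U \<and> map (val \<sigma>) ts = map \<nu> Xs \<and> naf_ok M r \<sigma> \<and>
       supported U M (rel_set p (V W)) r \<sigma>"
    then obtain \<sigma> where \<sigma>: "range \<sigma> \<subseteq> U" "map (val \<sigma>) ts = map \<nu> Xs" "naf_ok M r \<sigma>"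
      "supported U M (rel_set p (V W)) r \<sigma>" by blast
    \<comment> \<open>\<open>\<tau>\<close> follows \<open>\<sigma>\<close> on the rule and
      \<open>\<nu>\<close> elsewhere, as the quantifier block demands.\<close>
    define \<tau> where "\<tau> = (\<lambda>x. if x \<in> vars_rule r then \<sigma> x else \<nu> x)"
    have eq: "\<sigma> x = \<tau> x" if "x \<in> vars_rule r" for x using that by (simp add: \<tau>_def)
    have "val \<tau> t = val \<sigma> t" if "t \<in> set ts" for t
    proof (cases t)
      case (Var x)
      then have "x \<in> vars_atom (Rel p ts)" using that by (force simp: vars_atom_def)
      then show ?thesis using Var eq vars_pos_head[OF ts] by simp
    qed simp
    moreover have "map \<tau> Xs = map \<nu> Xs" using disj by (simp add: \<tau>_def)
    ultimately have "map (val \<tau>) ts = map \<tau> Xs" using \<sigma>(2) by (simp cong: map_cong)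
    moreover have "range \<tau> \<subseteq> U" "\<forall>x. x \<notin> vars_rule r \<longrightarrow> \<tau> x = \<nu> x"
      using \<sigma>(1) \<nu> by (auto simp: \<tau>_def)
    moreover have "supported U M (rel_set p (V W)) r \<tau>"
      using supported_cong[OF eq \<sigma>(1,4)] .
    moreover have "naf_ok M r \<tau>"
      using naf_ok_cong[of r \<sigma> \<tau> M, OF eq] \<sigma>(3) by blast
    ultimately show "sat U ?N V \<nu> (E_formula p W Xs ts r)"
      using E by blast
  qed
qed

section \<open>The operator of the fixed point formula\<close>

lemma map_assign: "distinct Xs \<Longrightarrow> length xs = length Xs \<Longrightarrow> map (assign \<nu> Xs xs) Xs = xs"
  by (auto simp: assign_def map_of_zip_nth intro!: nth_equalityI)

lemma range_assign: "range \<nu> \<subseteq> U \<Longrightarrow> set xs \<subseteq> U \<Longrightarrow> range (assign \<nu> Xs xs) \<subseteq> U"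
  by (auto simp: assign_def split: option.splits dest!: map_of_SomeD set_zip_rightD) blast+

text \<open>The least fixed points agree because the operators do: \<open>assign\<close> places a
  tuple on the distinct variables \<open>Xs\<close>, and each \<open>E_formula\<close> then
  describes the instances of one rule with that head tuple.\<close>

lemma sat_lfp_phi_formula:
  assumes P: "p_program p n P" and Xs: "distinct Xs" "length Xs = n" "set Xs \<inter> all_vars P = {}"
    and \<nu>: "range \<nu> \<subseteq> U"
  shows "sat U (completion_atoms P U M) V \<nu> (FLfp W Xs (phi_formula p W Xs P) (map Var Xs)) \<longleftrightarrow>
    map \<nu> Xs \<in> lfp (conseq p n P U M)"
proof -
  let ?N = "completion_atoms P U M"
  have fin: "finite {E_formula p W Xs ts r | ts r. r \<in> P \<and> Rel p ts \<in> pos (head r)}"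
    by (rule finite_E_formulas) (use P in \<open>simp add: p_program_def\<close>)
  have "sat U ?N (V(W := S)) (assign \<nu> Xs xs) (phi_formula p W Xs P) \<longleftrightarrow> xs \<in> S \<or>
      (\<exists>r\<in>P. \<exists>ts \<sigma>. Rel p ts \<in> pos (head r) \<and> range \<sigma> \<subseteq> U \<and> map (val \<sigma>) ts = xs \<and>
         naf_ok M r \<sigma> \<and> supported U M (rel_set p S) r \<sigma>)"
    if xs: "length xs = n" "set xs \<subseteq> U" for S xs
  proof -
    have m: "map (assign \<nu> Xs xs) Xs = xs" using map_assign Xs(1,2) xs(1) by metis
    note E = sat_E_formula[OF P _ _ Xs(2,3) range_assign[OF \<nu> xs(2), of Xs], where M = M and V = "V(W := S)" and W = W,
        unfolded m fun_upd_same]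
    have "sat U ?N (V(W := S)) (assign \<nu> Xs xs) (phi_formula p W Xs P) \<longleftrightarrow> xs \<in> S \<or>
        (\<exists>r\<in>P. \<exists>ts. Rel p ts \<in> pos (head r) \<and>
           sat U ?N (V(W := S)) (assign \<nu> Xs xs) (E_formula p W Xs ts r))"
      unfolding phi_formula_def sat.simps(7) sat_disj[OF fin] using m by (auto simp: comp_def)
    then show ?thesis using E by blast
  qed
  then have "conseq p n P U M = (\<lambda>S. {xs. length xs = length Xs \<and> set xs \<subseteq> U \<and>
      sat U ?N (V(W := S)) (assign \<nu> Xs xs) (phi_formula p W Xs P)})"
    unfolding conseq_def using Xs(2) by (intro ext) (auto simp del: Un_iff)
  then show ?thesis by (simp add: comp_def del: Un_iff)
qed

section \<open>Answer sets and the completion\<close>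

lemma models_compgl:
  assumes P: "p_program p n P" and U: "universe P U"
    and M: "M \<subseteq> {Rel p (map Const xs) | xs. length xs = n \<and> set xs \<subseteq> U}"
    and Xs: "distinct Xs" "length Xs = n" "set Xs \<inter> all_vars P = {}"
  shows "models U (completion_atoms P U M) (big_conj (compgl p Xs P)) \<longleftrightarrow>
    is_model M (gl_reduct M (geli_reduct U M (ground U P))) \<and> M \<subseteq> rel_set p (lfp (conseq p n P U M))"
proof -
  let ?N = "completion_atoms P U M"
  have gP: "generalized_program P" using P by (simp add: p_program_def)
  note fin = p_program_finite[OF P]
  \<comment> \<open>\<open>u\<close> witnesses the nonemptiness sentence and later is the default
    value outside \<open>Xs\<close>.\<close>
  obtain u where u: "u \<in> U" using U by (auto simp: universe_def)
  \<comment> \<open>Constants denote themselves, so different ones are unequal.\<close>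
  have "models U ?N (FNeg (FAtom (Equ (Const a) (Const b))))" if "a \<noteq> b" for a b
    using that by (simp add: models_def)
  moreover have "models U ?N (FEx 0 FTrue)"
    using u by (auto simp: models_def)
  moreover have "models U ?N (FIff (FAtom (rule_atom r))
      (FAnd (big_conj (fo_atom ` neg (head r)))
        (big_conj ((\<lambda>a. FNeg (fo_atom a)) ` neg (lits (body r))))))" if r: "r \<in> P" for r
    using sat_rule_atom[OF r finite_vars_rule[OF fin[OF r]]]
    by (auto simp: models_def sat_conj finite_neg finite_lits fin[OF r] sat_fo_atom naf_ok_def
        simp del: Un_iff sat.simps(3))
  moreover have "models U ?N (FIff (FAtom (gen_atom Ys \<phi> \<psi>)) (fo_bform \<phi>))"
    if "r \<in> P" "Gen Ys \<phi> \<psi> \<in> body r" for r Ys \<phi> \<psi>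
    using sat_gen_atom[OF that] by (simp add: models_def sat_fo_bform del: Un_iff sat.simps(3))
  \<comment> \<open>Only the rules and the fixed point sentence still constrain
    \<open>M\<close>.\<close>
  ultimately have 1: "models U ?N (big_conj (compgl p Xs P)) \<longleftrightarrow>
      (\<forall>r\<in>P. models U ?N (FImp (big_conj (fo_gliteral ` body r)) (big_disj (fo_lit ` head r)))) \<and>
      models U ?N (FImp (FAtom (Rel (Orig p) (map Var Xs)))
        (FLfp 0 Xs (phi_formula p 0 Xs P) (map Var Xs)))"
    unfolding models_big_conj[OF finite_compgl[OF gP]] unfolding compgl_def ball_Un
    by (auto simp: models_alls simp del: Un_iff)
  have 2: "(\<forall>r\<in>P. models U ?N (FImp (big_conj (fo_gliteral ` body r)) (big_disj (fo_lit ` head r)))) \<longleftrightarrow>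
      is_model M (gl_reduct M (geli_reduct U M (ground U P)))"
    unfolding is_model_reduct models_def using sat_rule[OF fin]
    by (metis (no_types, lifting))
  have "models U ?N (FImp (FAtom (Rel (Orig p) (map Var Xs)))
        (FLfp 0 Xs (phi_formula p 0 Xs P) (map Var Xs))) \<longleftrightarrow>
      (\<forall>\<nu>. range \<nu> \<subseteq> U \<longrightarrow> Rel p (map Const (map \<nu> Xs)) \<in> M \<longrightarrow> map \<nu> Xs \<in> lfp (conseq p n P U M))"
    unfolding models_def using sat_lfp_phi_formula[OF P Xs, of _ U M _ 0]
    by (auto simp: Rel_Orig_mem comp_def simp del: Un_iff sat.simps(12))
  also have "\<dots> \<longleftrightarrow> M \<subseteq> rel_set p (lfp (conseq p n P U M))" (is "?A \<longleftrightarrow> ?B")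
  proof
    assume A: ?A
    show ?B
    proof
      fix a assume a: "a \<in> M"
      with M obtain xs where xs: "a = Rel p (map Const xs)" "length xs = n" "set xs \<subseteq> U" by blast
      \<comment> \<open>The sentence speaks of valuations, so the tuple of an atom of
        \<open>M\<close> is turned into one.\<close>
      define \<nu> where "\<nu> = assign (\<lambda>_. u) Xs xs"
      have "range \<nu> \<subseteq> U" unfolding \<nu>_def by (rule range_assign) (use u xs in auto)
      moreover have "map \<nu> Xs = xs" unfolding \<nu>_def by (rule map_assign) (use Xs xs in auto)
      ultimately have "xs \<in> lfp (conseq p n P U M)"
        using A a xs(1) by blast
      then show "a \<in> rel_set p (lfp (conseq p n P U M))"
        unfolding xs(1) Rel_mem_rel_set .
    qed
  next
    assume ?B
    then show ?A
      unfolding subset_iff[of M] by (metis Rel_mem_rel_set)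
  qed
  finally show ?thesis using 1 2 by simp
qed

text \<open>Being a model is common to both sides of the final equivalence and therefore assumed
  here; what remains is to compare minimality with the fixed point.\<close>

lemma minimal_model_reduct_iff:
  assumes P: "p_program p n P"
    and M: "M \<subseteq> {Rel p (map Const xs) | xs. length xs = n \<and> set xs \<subseteq> U}"
    and model: "is_model M (gl_reduct M (geli_reduct U M (ground U P)))" (is "is_model M ?Q")
  shows "minimal_model M ?Q \<longleftrightarrow> M \<subseteq> rel_set p (lfp (conseq p n P U M))"
proof -
  define L where "L = lfp (conseq p n P U M)"
  have L: "conseq p n P U M L = L"
    unfolding L_def by (rule lfp_unfold[OF mono_conseq, symmetric])
  \<comment> \<open>Positive head atoms are never equalities, and \<open>p\<close> is the only
    predicate.\<close>
  have head: "\<exists>ts. a = Rel p ts" if "r \<in> P" "a \<in> pos (head r)" for r a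
  proof (cases a)
    case (Rel q ts)
    then show ?thesis using p_program_Rel(1)[OF P that(1)] atoms_ruleI(1)[OF that(2)] by blast
  next
    case (Equ s t)
    then show ?thesis
      using P that by (auto simp: p_program_def generalized_program_def is_rule_def)
  qed
  \<comment> \<open>Each atom of \<open>M\<close> comes from some admissible tuple; the injectivity
    behind \<open>Rel_mem_rel_set\<close> identifies it with \<open>xs\<close>.\<close>
  have Mxs: "length xs = n" "set xs \<subseteq> U" if "Rel p (map Const xs) \<in> M" for xs
  proof -
    have "M \<subseteq> rel_set p {xs. length xs = n \<and> set xs \<subseteq> U}"
      using M by (auto simp: rel_set_def)
    then have "Rel p (map Const xs) \<in> rel_set p {xs. length xs = n \<and> set xs \<subseteq> U}"
      using that by (rule subsetD)
    then have "xs \<in> {xs. length xs = n \<and> set xs \<subseteq> U}"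
      unfolding Rel_mem_rel_set .
    then show "length xs = n" "set xs \<subseteq> U" by auto
  qed
  show ?thesis
  proof
    assume min: "minimal_model M ?Q"
    have "is_model (M \<inter> rel_set p L) ?Q"
      unfolding is_model_reduct
    proof (intro ballI allI impI)
      fix r \<sigma> assume r: "r \<in> P" and \<sigma>: "range \<sigma> \<subseteq> U" "naf_ok M r \<sigma>"
        and supp: "supported U M (M \<inter> rel_set p L) r \<sigma>"
      \<comment> \<open>The model \<open>M\<close> supplies the head atom; in particular no rule
        without positive head atoms gets this far.\<close>
      have "supported U M M r \<sigma>" using supported_mono[OF supp] by blast
      then obtain a where a: "a \<in> pos (head r)" "holds_atom M (inst_atom UNIV \<sigma> a)"
        using model r \<sigma> unfolding is_model_reduct by blast
      then obtain ts where ts: "a = Rel p ts" using head[OF r] by blast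
      have inM: "Rel p (map Const (map (val \<sigma>) ts)) \<in> M"
        using a(2) unfolding ts inst_atom_UNIV_Rel by simp
      \<comment> \<open>The same support inside \<open>L\<close> puts the head tuple into
        \<open>conseq p n P U M L\<close>, which is \<open>L\<close>.\<close>
      have "supported U M (rel_set p L) r \<sigma>" using supported_mono[OF supp] by blast
      then have "map (val \<sigma>) ts \<in> conseq p n P U M L"
        using Mxs[OF inM] r a(1) ts \<sigma> by (auto simp: conseq_def)
      then have "Rel p (map Const (map (val \<sigma>) ts)) \<in> rel_set p L"
        unfolding L Rel_mem_rel_set .
      with inM have "holds_atom (M \<inter> rel_set p L) (inst_atom UNIV \<sigma> a)"
        unfolding ts inst_atom_UNIV_Rel by simp
      with a(1) show "\<exists>a\<in>pos (head r). holds_atom (M \<inter> rel_set p L) (inst_atom UNIV \<sigma> a)" by blast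
    qed
    with min have "\<not> M \<inter> rel_set p L \<subset> M" by (auto simp: minimal_model_def)
    then show "M \<subseteq> rel_set p (lfp (conseq p n P U M))" unfolding L_def by blast
  next
    assume sub: "M \<subseteq> rel_set p (lfp (conseq p n P U M))"
    have "M \<subseteq> J" if J: "J \<subseteq> M" "is_model J ?Q" for J
    proof -
      \<comment> \<open>\<open>S\<close> is \<open>J\<close> as a relation. Nothing is lost, since
        \<open>J\<close> lies in \<open>M\<close>, whose members are all \<open>p\<close>-atoms over
        constants.\<close>
      define S where "S = {xs. Rel p (map Const xs) \<in> J}"
      have JS: "rel_set p S = J"
        using J(1) M by (fastforce simp: rel_set_def S_def)
      have "conseq p n P U M S \<subseteq> S"
      proof
        fix xs assume "xs \<in> conseq p n P U M S"
        then consider "xs \<in> S" | r ts \<sigma> where "r \<in> P" "Rel p ts \<in> pos (head r)" "range \<sigma> \<subseteq> U"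
          "map (val \<sigma>) ts = xs" "naf_ok M r \<sigma>" "supported U M J r \<sigma>"
          unfolding conseq_def JS by blast
        then show "xs \<in> S"
        proof cases
          case 2
          then obtain a where a: "a \<in> pos (head r)" "holds_atom J (inst_atom UNIV \<sigma> a)"
            using J(2) unfolding is_model_reduct by blast
          \<comment> \<open>The head atom found in \<open>J\<close> must be the one that produced
            \<open>xs\<close>, as there is at most one positive head atom.\<close>
          have "card (pos (head r)) \<le> 1" "finite (pos (head r))"
            using P 2(1) finite_pos[OF p_program_finite(1)[OF P 2(1)]]
            by (auto simp: p_program_def generalized_program_def is_rule_def)
          then have "a = Rel p ts"
            using a(1) 2(2) by (metis One_nat_def card_le_Suc0_iff_eq)
          then have "Rel p (map Const (map (val \<sigma>) ts)) \<in> J"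
            using a(2) by (simp only: inst_atom_UNIV_Rel holds_atom.simps)
          then show ?thesis using 2(4) by (simp add: S_def)
        qed
      qed
      \<comment> \<open>A pre-fixed point bounds the least fixed point from above.\<close>
      then have "lfp (conseq p n P U M) \<subseteq> S" by (rule lfp_lowerbound)
      then show ?thesis using sub unfolding JS[symmetric] rel_set_def by blast
    qed
    with model show "minimal_model M ?Q" unfolding minimal_model_def by blast
  qed
qed

text \<open>Without a rule for \<open>p\<close> the operator can only return tuples of its argument,
  so the empty set is already a pre-fixed point.\<close>

lemma lfp_conseq_no_head:
  assumes "\<And>r ts. r \<in> P \<Longrightarrow> Rel p ts \<notin> pos (head r)"
  shows "lfp (conseq p n P U M) = {}"
proof -
  have "conseq p n P U M {} \<subseteq> {}" using assms by (auto simp: conseq_def)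
  then show ?thesis using lfp_lowerbound by blast
qed

theorem theorem6p6:
  fixes P :: "('p, 'c) grule set" and p :: 'p and n :: nat
    and U :: "'c set" and M :: "('p, 'c) atom set" and Xs :: "var list"
  assumes "p_program p n P"
    and "universe P U"
    and "M \<subseteq> {Rel p (map Const xs) | xs. length xs = n \<and> set xs \<subseteq> U}"
    and "distinct Xs" and "length Xs = n" and "set Xs \<inter> all_vars P = {}"
  shows "open_answer_set P U M \<longleftrightarrow>
    models U (lift_atom ` M \<union> R_set P U M \<union> G_set P U M) (big_conj (compgl p Xs P))"
proof -
  \<comment> \<open>An open answer set uses only predicates of \<open>P\<close>, whereas
    \<open>M\<close> may be given over a \<open>p\<close> that does not occur in \<open>P\<close>.
    The fixed point condition closes this gap: either \<open>p\<close> occurs in a head, or the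
    fixed point and with it \<open>M\<close> are empty.\<close>
  have "M \<subseteq> ground_atoms (preds P) U" if sub: "M \<subseteq> rel_set p (lfp (conseq p n P U M))"
  proof (cases "\<exists>r\<in>P. \<exists>ts. Rel p ts \<in> pos (head r)")
    case True
    then obtain r ts where r: "r \<in> P" "Rel p ts \<in> atoms_rule r"
      using atoms_ruleI(1) by blast
    then have "(p, length ts) \<in> preds P" by (auto simp: preds_def)
    then have "(p, n) \<in> preds P" using p_program_Rel(2)[OF assms(1) r] by simp
    then show ?thesis using assms(3) unfolding ground_atoms_def by blast
  next
    case False
    then have "lfp (conseq p n P U M) = {}" by (intro lfp_conseq_no_head) blast
    then show ?thesis using sub by (simp add: rel_set_def)
  qed
  then show ?thesis
    unfolding models_compgl[OF assms] open_answer_set_def answer_set_def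
    using minimal_model_reduct_iff[OF assms(1,3)] assms(2) minimal_model_def by metis
qed

end
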